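(* Let $\epsilon=(u_1,v_1,\dots,u_6,v_6)$ be a tuple over $\mathbb{F}_3^*$. 1. $\Lambda_{4,3}$ has a cycle of type $\epsilon$ iff there are $a,b,c,r\in\mathbb{F}_3^*$ such that $\epsilon$ equals one of $(a,r,b,-r,a,r,b,-r,a,r,b,-r)$, $(a,r,b,-r,-a,-r,-a,-r,-b,r,a,r)$, $(a,r,a,r,c,-r,-a,-r,-a,-r,-c,r)$, $(a,r,b,r,b,r,-a,-r,-b,-r,-b,-r)$, $(a,r,-a,r,a,r,-a,r,a,r,-a,r)$. 2. For $k=5,6$, $\Lambda_{k,3}$ has a cycle of type $\epsilon$ iff there are $a,b,c,d\in\mathbb{F}_3^*$ with $(a+b)(c+d)=0$ such that $\epsilon=(a,c,b,d,a,c,b,d,a,c,b,d)$. 3. $\Lambda_{7,3}$ has a cycle of type $\epsilon$ iff there are $a,b,c\in\mathbb{F}_3^*$ such that $\epsilon=(a,c,b,-c,a,c,b,-c,a,c,b,-c)$. 4. $\Lambda_{8,3}$ has a cycle of type $\epsilon$ iff there are $a,c\in\mathbb{F}_3^*$ such that $\epsilon=(a,c,-a,-c,a,c,-a,-c,a,c,-a,-c)$. 5. For $4\le k\le8$, $g(\Lambda_{k,3})=12$. 6. $g(\Lambda_{9,3})\ge14$.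
   Context: For a prime power $q$ and integer $k\ge2$, $\Lambda_{k,q}$ is the bipartite graph with vertex set $L_k\cup R_k$ (regarded as disjoint), where $L_k$ is the set of vectors $[l]=(l_0,\dots,l_k)\in\mathbb{F}_q^{k+1}$ with $l_1=l_2$ and $R_k$ the set of vectors $\langle r\rangle=(r_0,\dots,r_k)\in\mathbb{F}_q^{k+1}$ with $r_1=0$; edges join only $L_k$ to $R_k$, and $[l]\sim\langle r\rangle$ iff for every $2\le i\le k$: $l_i+r_i=r_0l_{i-2}$ if $i\equiv2,3\pmod4$, and $l_i+r_i=l_0r_{i-2}$ if $i\equiv0,1\pmod4$. A cycle of length $2n$ through the edge joining the two all-zero vectors is written $[l^{(1)}],\langle r^{(1)}\rangle,\dots,[l^{(n)}],\langle r^{(n)}\rangle$ (distinct vertices, consecutive ones adjacent, $\langle r^{(n)}\rangle\sim[l^{(1)}]$) with $[l^{(1)}]$ and $\langle r^{(1)}\rangle$ the all-zero vectors. Put $x_i=l^{(i)}_0$, $y_i=r^{(i)}_0$ ($1\le i\le n$), $x_{n+1}=y_{n+1}=0$, $u_i=x_{i+1}-x_i$, $v_i=y_{i+1}-y_i$; the tuple $(u_1,v_1,\dots,u_n,v_n)$ is the type of the cycle, and "has a cycle of type $\epsilon$" means such a cycle with type $\epsilon$ exists. $g(G)$ denotes the girth of $G$. *)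

theory Defs
  imports
    "Graph_Theory.Pair_Digraph"
    "HOL-Library.Extended_Nat"
    "HOL-Library.Cardinality"
begin

text \<open>
  The field with \<open>q\<close> elements is a type \<open>'a\<close> of sort \<open>{field, finite}\<close> with \<open>CARD('a) = q\<close>.
  A vector with coordinates indexed by \<open>0, ..., k\<close> is a list of length \<open>k + 1\<close>.
\<close>

definition L_verts :: "nat \<Rightarrow> 'a::{field,finite} list set" where
  "L_verts k = {l. length l = k + 1 \<and> l ! 1 = l ! 2}"

definition R_verts :: "nat \<Rightarrow> 'a::{field,finite} list set" where
  "R_verts k = {r. length r = k + 1 \<and> r ! 1 = 0}"

definition incident :: "nat \<Rightarrow> 'a::{field,finite} list \<Rightarrow> 'a list \<Rightarrow> bool" where
  "incident k l r \<longleftrightarrow>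
     l \<in> L_verts k \<and> r \<in> R_verts k \<and>
     (\<forall>i\<in>{2..k}. l ! i + r ! i =
        (if i mod 4 \<in> {2, 3} then r ! 0 * l ! (i - 2) else l ! 0 * r ! (i - 2)))"

text \<open>
  An undirected graph is a symmetric digraph, each edge giving two opposite arcs.
  The sum type keeps the two vertex classes disjoint.
\<close>

definition Lambda :: "nat \<Rightarrow> ('a::{field,finite} list + 'a list) pair_pre_digraph" where
  "Lambda k =
     \<lparr> pverts = L_verts k <+> R_verts k,
       parcs = {(Inl l, Inr r) | l r. incident k l r} \<union> {(Inr r, Inl l) | l r. incident k l r} \<rparr>"

text \<open>
  A pair of opposite arcs is a directed cycle of length 2 but not a cycle of the
  undirected graph, hence the bound on the length. The girth of a forest is \<open>\<infinity>\<close>.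
\<close>

definition girth :: "'v pair_pre_digraph \<Rightarrow> enat" where
  "girth G = (INF p \<in> {p. pre_digraph.cycle (with_proj G) p \<and> 3 \<le> length p}. enat (length p))"

text \<open>
  The sequence \<open>l 1, r 1, ..., l n, r n\<close> is a cycle of length \<open>2 * n\<close> whose first edge joins
  the two zero vectors. Only the values of \<open>l\<close> and \<open>r\<close> on \<open>{1..n}\<close> matter.
\<close>

definition cycle_through_zero ::
  "nat \<Rightarrow> nat \<Rightarrow> (nat \<Rightarrow> 'a::{field,finite} list) \<Rightarrow> (nat \<Rightarrow> 'a list) \<Rightarrow> bool" where
  "cycle_through_zero k n l r \<longleftrightarrow>
     2 \<le> n \<and>
     inj_on l {1..n} \<and> inj_on r {1..n} \<and>
     (\<forall>i\<in>{1..n}. (Inl (l i), Inr (r i)) \<in> parcs (Lambda k)) \<and>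
     (\<forall>i\<in>{1..<n}. (Inr (r i), Inl (l (i + 1))) \<in> parcs (Lambda k)) \<and>
     (Inr (r n), Inl (l 1)) \<in> parcs (Lambda k) \<and>
     l 1 = replicate (k + 1) 0 \<and> r 1 = replicate (k + 1) 0"

definition cycle_type ::
  "nat \<Rightarrow> (nat \<Rightarrow> 'a::{field,finite} list) \<Rightarrow> (nat \<Rightarrow> 'a list) \<Rightarrow> 'a list" where
  "cycle_type n l r =
     (let x = (\<lambda>i. if i = n + 1 then 0 else l i ! 0);
          y = (\<lambda>i. if i = n + 1 then 0 else r i ! 0)
      in concat (map (\<lambda>i. [x (i + 1) - x i, y (i + 1) - y i]) [1..<n + 1]))"

definition has_cycle_of_type :: "nat \<Rightarrow> 'a::{field,finite} list \<Rightarrow> bool" where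
  "has_cycle_of_type k \<epsilon> \<longleftrightarrow>
     (\<exists>n l r. cycle_through_zero k n l r \<and> cycle_type n l r = \<epsilon>)"

end

theory Submission
  imports Defs
begin

text \<open>
  The automorphism group of the graph is transitive on edges by maps that translate the \<open>0\<close>-th
  coordinates, so every closed walk without backtracking can be moved to the zero edge without
  changing its type. From the zero edge a walk is determined by its type, and its type is a
  word over \<open>{1, -1}\<close>; whether it closes is a computation modulo \<open>3\<close>. Enumerating the finitely
  many words of length up to \<open>12\<close> gives the types for \<open>k = 4\<close>, of which the types for larger
  \<open>k\<close> form a subset since forgetting the last coordinate preserves closed walks.
\<close>

section \<open>The field with three elements\<close>

text \<open>Moving edges serves the girth: the four statements on types already speak of cycles
  through the zero edge, whereas a shortest cycle may lie anywhere. Backtracking is visible in the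
  type. Two neighbours of a vertex that agree in coordinate 0 are equal, so a walk does not
  backtrack exactly when all increments are nonzero, and over the field with three elements this
  leaves two signs. A word that closes yields a closed walk, not yet a cycle. For the lower bounds
  on the girth this is enough, because every cycle is such a closed walk. For the types, repeated
  vertices inside the walk must be excluded as well, which is a second computation on the words
  found for \<open>k = 4\<close>. The enumeration stays small because coordinate 0 alone forces both
  halves of a word to have sum zero modulo 3: at length 12 this leaves 22 of 64 words for each
  half.\<close>

lemma of_nat_CARD_eq_0: "of_nat CARD('a::{ring_1,finite}) = (0::'a)"
proof -
  \<comment> \<open>Translation by 1 permutes the ring; comparing the two sums leaves
    \<open>CARD('a)\<close> copies of 1.\<close>
  have "(\<Sum>x\<in>UNIV. x) = (\<Sum>x\<in>UNIV. x + (1::'a))"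
    by (rule sum.reindex_bij_witness[of _ "\<lambda>x. x + 1" "\<lambda>x. x - 1"]) auto
  then show ?thesis by (simp add: sum.distrib)
qed

text \<open>Since 3 = 0, only the residue modulo 3 matters, and residue 2 stays nonzero because 2 =
  0 would give 1 = 0.\<close>

lemma of_int_eq_0_iff_3_dvd:
  assumes "CARD('a::{field,finite}) = 3"
  shows "of_int x = (0::'a) \<longleftrightarrow> 3 dvd x"
proof -
  have three: "(3::'a) = 0"
    using of_nat_CARD_eq_0[where 'a = 'a] assms by simp
  have two: "(2::'a) \<noteq> 0"
  proof
    assume "(2::'a) = 0"
    moreover have "(3::'a) = 2 + 1" by simp
    ultimately show False using three by simp
  qed
  have "(of_int (3 * (x div 3) + x mod 3) :: 'a) = of_int (x mod 3)"
    by (simp only: of_int_add of_int_mult of_int_numeral three) simp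
  then have "(of_int x :: 'a) = of_int (x mod 3)"
    by (simp only: mult_div_mod_eq)
  moreover have "x mod 3 = 0 \<or> x mod 3 = 1 \<or> x mod 3 = 2" by presburger
  ultimately show ?thesis using two by (auto simp: dvd_eq_mod_eq_0)
qed

lemma of_int_eq_iff_mod_3:
  assumes "CARD('a::{field,finite}) = 3"
  shows "of_int x = (of_int y::'a) \<longleftrightarrow> x mod 3 = y mod 3"
  using of_int_eq_0_iff_3_dvd[OF assms, of "x - y"]
  by (simp add: mod_eq_dvd_iff)

text \<open>Integer representatives of the nonzero field elements, as a list so that words over them
  can be enumerated by evaluation.\<close>

definition signs :: "int list" where
  "signs = [1, -1]"

lemma nonzero_eq_image_signs:
  assumes "CARD('a::{field,finite}) = 3"
  shows "- {0::'a} = of_int ` set signs"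
proof -
  have ne: "(1::'a) \<noteq> - 1"
    using of_int_eq_iff_mod_3[OF assms, of 1 "- 1"] by simp
  have "card (- {0::'a}) = 2"
    using assms by (simp add: Compl_eq_Diff_UNIV)
  moreover have "{1, - 1} \<subseteq> - {0::'a}" by auto
  moreover have "card {1, - 1 :: 'a} = 2" using ne by simp
  ultimately have "{1, - 1} = - {0::'a}" by (intro card_subset_eq) auto
  then show ?thesis by (auto simp: signs_def)
qed

text \<open>Allows membership in a set of field words to be read back as membership in the computed
  list of integer words.\<close>

lemma inj_on_map_of_int_signs:
  assumes "CARD('a::{field,finite}) = 3"
  shows "inj_on (map (of_int :: int \<Rightarrow> 'a)) (lists (set signs))"
proof -
  have "inj_on (of_int :: int \<Rightarrow> 'a) (set signs)"
    unfolding inj_on_def of_int_eq_iff_mod_3[OF assms] by (simp add: signs_def)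
  then show ?thesis by (rule inj_on_mapI[OF inj_on_subset]) auto
qed

lemma ex_signs_if_nonzero:
  assumes "CARD('a::{field,finite}) = 3" "0 \<notin> set (zs :: 'a list)"
  obtains e where "zs = map of_int e" "set e \<subseteq> set signs"
proof -
  have "zs \<in> lists (of_int ` set signs)"
    using assms(2) unfolding nonzero_eq_image_signs[OF assms(1), symmetric] by auto
  then have "zs \<in> map of_int ` lists (set signs)" by (simp add: lists_image)
  with that show ?thesis by auto
qed

section \<open>Coordinates along a walk from the zero edge\<close>

text \<open>
  \<open>coord us vs j\<close> lists the \<open>j\<close>-th coordinates of the vertices of the walk that starts at the
  zero edge and whose \<open>0\<close>-th coordinates have the increments \<open>us\<close> and \<open>vs\<close>. Subtracting
  the two adjacency equations of a vertex gives \<open>l' ! j - l ! j = r ! 0 * (l' ! (j-2) - l ! (j-2))\<close>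
  or \<open>(l' ! 0 - l ! 0) * r ! (j-2)\<close>, so all these coordinates are partial sums. The redexes
  below stand for let-bindings: \<open>code_simp\<close> evaluates their arguments only once.
\<close>

fun partial_sums :: "'a::monoid_add \<Rightarrow> 'a list \<Rightarrow> 'a list" where
  "partial_sums s [] = [s]"
| "partial_sums s (x # xs) = s # partial_sums (s + x) xs"

text \<open>The differences of \<open>ps\<close> are weighted by \<open>ys\<close> because the i-th
  right vertex is adjacent to the i-th and to the next left vertex. The right coordinate is then
  solved from the adjacency of the i-th pair.\<close>

definition step_L :: "'a::comm_ring_1 list \<Rightarrow> 'a list \<times> 'a list \<Rightarrow> 'a list \<times> 'a list" where
  "step_L vs = (\<lambda>(ps, qs).
     (\<lambda>ys. (\<lambda>ls. (ls, map2 (-) (map2 (*) ys ps) ls))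
        (partial_sums 0 (map2 (*) ys (map2 (-) (tl ps) ps)))) (partial_sums 0 vs))"

definition step_R :: "'a::comm_ring_1 list \<Rightarrow> 'a list \<times> 'a list \<Rightarrow> 'a list \<times> 'a list" where
  "step_R us = (\<lambda>(ps, qs).
     (\<lambda>ls. (ls, map2 (-) (map2 (*) (partial_sums 0 us) qs) ls))
        (partial_sums 0 (map2 (*) qs us)))"

fun coord :: "'a::comm_ring_1 list \<Rightarrow> 'a list \<Rightarrow> nat \<Rightarrow> 'a list \<times> 'a list" where
  "coord us vs 0 = (partial_sums 0 us, partial_sums 0 vs)"
| "coord us vs (Suc 0) = (fst (step_L vs (coord us vs 0)), map (\<lambda>_. 0) (partial_sums 0 us))"
| "coord us vs (Suc (Suc j)) =
     (if j mod 4 < 2 then step_L vs else step_R us) (coord us vs j)"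

lemma length_partial_sums [simp]: "length (partial_sums s xs) = Suc (length xs)"
  by (induction xs arbitrary: s) auto

lemma partial_sums_nth_0 [simp]: "partial_sums s xs ! 0 = s"
  by (cases xs) auto

lemma partial_sums_nth_Suc:
  "i < length xs \<Longrightarrow> partial_sums s xs ! Suc i = partial_sums s xs ! i + xs ! i"
proof (induction xs arbitrary: s i)
  case (Cons x xs)
  then show ?case by (cases i) auto
qed auto

lemma last_partial_sums: "last (partial_sums s xs) = s + sum_list xs"
proof (induction xs arbitrary: s)
  case (Cons x xs)
  moreover have "partial_sums (s + x) xs \<noteq> []" by (cases xs) auto
  ultimately show ?case by (simp add: add.assoc)
qed auto

lemma map_of_int_partial_sums:
  "map of_int (partial_sums s xs) = partial_sums (of_int s) (map of_int xs)"
  by (induction xs arbitrary: s) auto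

text \<open>All operations in \<open>coord\<close> are ring operations, so they commute with the
  homomorphism \<open>of_int\<close>. A walk over the field can thus be computed over the
  integers.\<close>

lemma map_of_int_coord:
  "(coord (map of_int us) (map of_int vs) j :: 'a::comm_ring_1 list \<times> 'a list) =
     map_prod (map of_int) (map of_int) (coord us vs j)"
proof -
  have *: "map2 (-) (map of_int xs) (map of_int ys) = map of_int (map2 (-) xs ys)"
    "map2 (*) (map of_int xs) (map of_int ys) = map of_int (map2 (*) xs ys)" for xs ys
    by (simp_all add: map_zip_map map_zip_map2 zip_map_map split_def)
  have **: "partial_sums 0 (map of_int xs) = map of_int (partial_sums 0 xs)" for xs
    by (simp add: map_of_int_partial_sums)
  have L: "step_L (map of_int vs) (map_prod (map of_int) (map of_int) c) =
      (map_prod (map of_int) (map of_int) (step_L vs c) :: 'a list \<times> 'a list)" for c vs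
    by (cases c) (simp add: step_L_def * ** map_tl[symmetric] del: map_map)
  have R: "step_R (map of_int us) (map_prod (map of_int) (map of_int) c) =
      (map_prod (map of_int) (map of_int) (step_R us c) :: 'a list \<times> 'a list)" for c us
    by (cases c) (simp add: step_R_def * ** del: map_map)
  show ?thesis
  proof (induction us vs j rule: coord.induct)
    case (2 us vs)
    then show ?case
      using L[of vs "(partial_sums 0 us, partial_sums 0 vs)"] by (simp add: ** comp_def)
  qed (simp_all add: ** L R)
qed

lemma length_coord [simp]:
  assumes "length us = n" "length vs = n"
  shows "length (fst (coord us vs j)) = Suc n" "length (snd (coord us vs j)) = Suc n"
  using assms
  by (induction us vs j rule: coord.induct) (auto simp: step_L_def step_R_def split_def)

lemma coord_nth_0:
  assumes "length us = n" "length vs = n"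
  shows "fst (coord us vs j) ! 0 = 0" "snd (coord us vs j) ! 0 = 0"
proof -
  have "fst (coord us vs j) ! 0 = 0 \<and> snd (coord us vs j) ! 0 = 0"
    using assms
    by (induction us vs j rule: coord.induct) (auto simp: step_L_def step_R_def split_def)
  then show "fst (coord us vs j) ! 0 = 0" "snd (coord us vs j) ! 0 = 0" by auto
qed

lemma coord_1: "fst (coord us vs 1) = fst (coord us vs 2)"
  by (simp add: numeral_2_eq_2)

lemma coord_1_R: "length us = n \<Longrightarrow> i \<le> n \<Longrightarrow> snd (coord us vs 1) ! i = 0"
  by simp

lemma mod_4_add_2: "Suc (Suc j) mod 4 \<in> {2, 3} \<longleftrightarrow> j mod 4 < 2"
  by (simp; presburger)

lemma coord_incident:
  assumes "length us = n" "length vs = n" "i \<le> n"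
  shows "fst (coord us vs (Suc (Suc j))) ! i + snd (coord us vs (Suc (Suc j))) ! i =
    (if j mod 4 < 2 then partial_sums 0 vs ! i * fst (coord us vs j) ! i
     else partial_sums 0 us ! i * snd (coord us vs j) ! i)"
  using assms length_coord[OF assms(1,2), of j]
  by (simp add: step_L_def step_R_def split_def)

text \<open>The increment of the left coordinate is by design the change of the right-hand side when
  the left neighbour advances, so the equation at \<open>i\<close> carries over.\<close>

lemma coord_incident_Suc:
  assumes "length us = n" "length vs = n" "i < n"
  shows "fst (coord us vs (Suc (Suc j))) ! Suc i + snd (coord us vs (Suc (Suc j))) ! i =
    (if j mod 4 < 2 then partial_sums 0 vs ! i * fst (coord us vs j) ! Suc i
     else partial_sums 0 us ! Suc i * snd (coord us vs j) ! i)"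
  using assms length_coord[OF assms(1,2), of j]
  by (simp add: step_L_def step_R_def split_def partial_sums_nth_Suc nth_tl algebra_simps)

text \<open>Shifting the index by 2 turns the case distinction into \<open>j mod 4 < 2\<close>, the
  form used in the recursion of \<open>coord\<close>.\<close>

lemma incident_iff:
  "incident k l r \<longleftrightarrow> l \<in> L_verts k \<and> r \<in> R_verts k \<and>
     (\<forall>j. Suc (Suc j) \<le> k \<longrightarrow> l ! Suc (Suc j) + r ! Suc (Suc j) =
        (if j mod 4 < 2 then r ! 0 * l ! j else l ! 0 * r ! j))"
proof -
  have *: "(\<forall>i\<in>{2..k}. P i) \<longleftrightarrow> (\<forall>j. Suc (Suc j) \<le> k \<longrightarrow> P (Suc (Suc j)))" for P
  proof (intro iffI allI impI ballI)
    fix i assume "\<forall>j. Suc (Suc j) \<le> k \<longrightarrow> P (Suc (Suc j))" "i \<in> {2..k}"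
    then show "P i" by (cases i; cases "i - 1") auto
  qed auto
  have "Suc (Suc j) - 2 = j" for j by simp
  then show ?thesis unfolding incident_def * mod_4_add_2 by simp
qed

text \<open>Coordinate \<open>1\<close> of a left vertex is only determined through coordinate \<open>2\<close>.\<close>

lemma vertex_index_induct [consumes 1, case_names 0 2 1 step]:
  fixes P :: "nat \<Rightarrow> bool"
  assumes "2 \<le> k" "P 0" "P 0 \<Longrightarrow> P 2" "P 2 \<Longrightarrow> P 1"
    and "\<And>j. Suc (Suc j) \<le> k \<Longrightarrow> P j \<Longrightarrow> P (Suc (Suc j))"
    and "j \<le> k"
  shows "P j"
  using assms(6)
proof (induction j rule: less_induct)
  case (less j)
  show ?case
  proof (cases "j < 2")
    case True
    then show ?thesis using assms(1-4) by (auto simp: less_2_cases_iff)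
  next
    case False
    then obtain i where "j = Suc (Suc i)" by (metis One_nat_def Suc_1 less_Suc_eq_0_disj not0_implies_Suc)
    then show ?thesis using less assms(5)[of i] by simp
  qed
qed

section \<open>Walks and their increments\<close>

definition walk :: "nat \<Rightarrow> nat \<Rightarrow> (nat \<Rightarrow> 'a::{field,finite} list) \<Rightarrow> (nat \<Rightarrow> 'a list) \<Rightarrow> bool" where
  "walk k n l r \<longleftrightarrow>
     (\<forall>i\<le>n. incident k (l i) (r i)) \<and> (\<forall>i<n. incident k (l (Suc i)) (r i))"

text \<open>Index \<open>n\<close> repeats the first edge, whereas \<open>cycle_through_zero\<close>
  counts from 1 to \<open>n\<close> without repetition.\<close>

definition closed_walk :: "nat \<Rightarrow> nat \<Rightarrow> (nat \<Rightarrow> 'a::{field,finite} list) \<Rightarrow> (nat \<Rightarrow> 'a list) \<Rightarrow> bool" where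
  "closed_walk k n l r \<longleftrightarrow> walk k n l r \<and> l n = l 0 \<and> r n = r 0"

definition starts_at_zero :: "nat \<Rightarrow> (nat \<Rightarrow> 'a::{field,finite} list) \<Rightarrow> (nat \<Rightarrow> 'a list) \<Rightarrow> bool" where
  "starts_at_zero k l r \<longleftrightarrow> l 0 = replicate (k + 1) 0 \<and> r 0 = replicate (k + 1) 0"

definition steps :: "(nat \<Rightarrow> 'a::{field,finite} list) \<Rightarrow> nat \<Rightarrow> 'a list" where
  "steps l n = map (\<lambda>i. l (Suc i) ! 0 - l i ! 0) [0..<n]"

lemma length_steps [simp]: "length (steps l n) = n"
  by (simp add: steps_def)

lemma partial_sums_steps:
  "i \<le> n \<Longrightarrow> l 0 ! 0 = 0 \<Longrightarrow> partial_sums 0 (steps l n) ! i = l i ! 0"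
proof (induction i)
  case (Suc i)
  then show ?case by (simp add: partial_sums_nth_Suc) (simp add: steps_def)
qed auto

text \<open>Uniqueness of the walk with given increments, by induction on the coordinate and, for
  each coordinate, along the walk.\<close>

lemma coord_walk:
  assumes "2 \<le> k" "walk k n l r" "starts_at_zero k l r" "j \<le> k" "i \<le> n"
  shows "fst (coord (steps l n) (steps r n) j) ! i = l i ! j"
    and "snd (coord (steps l n) (steps r n) j) ! i = r i ! j"
proof -
  define us vs where us_vs_def: "us = steps l n" "vs = steps r n"
  have len: "length us = n" "length vs = n" by (simp_all add: us_vs_def)
  define P where "P j \<longleftrightarrow>
    (\<forall>i\<le>n. fst (coord us vs j) ! i = l i ! j \<and> snd (coord us vs j) ! i = r i ! j)" for j
  have z: "l 0 ! j = 0" "r 0 ! j = 0" if "j \<le> k" for j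
    using assms(3) that by (simp_all add: starts_at_zero_def del: replicate_Suc)
  have ps: "partial_sums 0 us ! i = l i ! 0" "partial_sums 0 vs ! i = r i ! 0" if "i \<le> n" for i
    using that z[of 0] by (simp_all add: us_vs_def partial_sums_steps)
  have P0: "P 0" using ps by (simp add: P_def)
  have Pstep: "P (Suc (Suc j))" if "Suc (Suc j) \<le> k" "P j" for j
  proof -
    let ?j = "Suc (Suc j)"
    let ?L = "\<lambda>i. fst (coord us vs ?j) ! i" and ?R = "\<lambda>i. snd (coord us vs ?j) ! i"
    have a: "?L i + ?R i = l i ! ?j + r i ! ?j" if i: "i \<le> n" for i
    proof -
      have "incident k (l i) (r i)" using assms(2) i by (simp add: walk_def)
      then show ?thesis
        using \<open>P j\<close> i \<open>?j \<le> k\<close> coord_incident[OF len i, of j] ps[OF i]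
        unfolding P_def incident_iff by simp
    qed
    have b: "?L (Suc i) + ?R i = l (Suc i) ! ?j + r i ! ?j" if i: "i < n" for i
    proof -
      have "incident k (l (Suc i)) (r i)" using assms(2) i by (simp add: walk_def)
      then show ?thesis
        using \<open>P j\<close> i \<open>?j \<le> k\<close> coord_incident_Suc[OF len i, of j] ps[of i] ps[of "Suc i"]
        unfolding P_def incident_iff by simp
    qed
    \<comment> \<open>Zigzag: \<open>b\<close> passes from the right vertex at \<open>i\<close> to
      the left vertex at \<open>Suc i\<close>, and \<open>a\<close> from there to the right vertex
      at \<open>Suc i\<close>.\<close>
    have "i \<le> n \<longrightarrow> ?L i = l i ! ?j \<and> ?R i = r i ! ?j" for i
    proof (induction i)
      case 0
      show ?case unfolding coord_nth_0[OF len] z[OF that(1)] by simp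
    next
      case (Suc i)
      show ?case using Suc a[of "Suc i"] b[of i] by auto
    qed
    then show ?thesis by (simp add: P_def)
  qed
  have "P j"
  proof (use assms(1) _ _ _ _ assms(4) in \<open>rule vertex_index_induct\<close>)
    show "P 2" if "P 0" using Pstep[of 0] that assms(1) by (simp add: numeral_2_eq_2)
    show "P 1" if "P 2"
    proof -
      have "l i ! 1 = l i ! 2 \<and> r i ! 1 = 0" if "i \<le> n" for i
        using assms(2) that by (auto simp: walk_def incident_def L_verts_def R_verts_def)
      then show ?thesis
        using \<open>P 2\<close> coord_1_R[OF len(1), of _ vs] unfolding P_def coord_1 by simp
    qed
  qed (use P0 Pstep in auto)
  then show "fst (coord (steps l n) (steps r n) j) ! i = l i ! j"
    "snd (coord (steps l n) (steps r n) j) ! i = r i ! j"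
    using assms(5) by (simp_all add: P_def us_vs_def)
qed

definition coord_walk_L :: "nat \<Rightarrow> 'a::{field,finite} list \<Rightarrow> 'a list \<Rightarrow> nat \<Rightarrow> 'a list" where
  "coord_walk_L k us vs i = map (\<lambda>j. fst (coord us vs j) ! i) [0..<Suc k]"

definition coord_walk_R :: "nat \<Rightarrow> 'a::{field,finite} list \<Rightarrow> 'a list \<Rightarrow> nat \<Rightarrow> 'a list" where
  "coord_walk_R k us vs i = map (\<lambda>j. snd (coord us vs j) ! i) [0..<Suc k]"

lemma coord_walk_nth:
  assumes "j \<le> k"
  shows "coord_walk_L k us vs i ! j = fst (coord us vs j) ! i"
    "coord_walk_R k us vs i ! j = snd (coord us vs j) ! i"
  using assms by (simp_all add: coord_walk_L_def coord_walk_R_def nth_append del: upt_Suc)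

text \<open>Existence counterpart of \<open>coord_walk\<close>: every pair of increment words of
  equal length comes from a walk, closed or not.\<close>

lemma walk_coord_walk:
  assumes "2 \<le> k" "length us = n" "length vs = n"
  shows "walk k n (coord_walk_L k us vs) (coord_walk_R k us vs)"
    and "starts_at_zero k (coord_walk_L k us vs) (coord_walk_R k us vs)"
    and "steps (coord_walk_L k us vs) n = us"
    and "steps (coord_walk_R k us vs) n = vs"
proof -
  note nth = coord_walk_nth
  have "length (coord_walk_L k us vs i) = k + 1" "length (coord_walk_R k us vs i) = k + 1" for i
    by (simp_all add: coord_walk_L_def coord_walk_R_def)
  moreover have "coord_walk_L k us vs i ! 1 = coord_walk_L k us vs i ! 2" for i
    using assms(1) by (simp only: nth[of 1 k] nth[of 2 k] coord_1)
  moreover have "coord_walk_R k us vs i ! 1 = 0" if "i \<le> n" for i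
    using assms(1) coord_1_R[OF assms(2) that] by (simp only: nth[of 1 k])
  ultimately have verts: "coord_walk_L k us vs i \<in> L_verts k"
    "i \<le> n \<Longrightarrow> coord_walk_R k us vs i \<in> R_verts k" for i
    by (simp_all add: L_verts_def R_verts_def)
  show "walk k n (coord_walk_L k us vs) (coord_walk_R k us vs)"
    unfolding walk_def incident_iff
    using verts coord_incident[OF assms(2,3)] coord_incident_Suc[OF assms(2,3)]
    by (auto simp: nth simp del: coord.simps(3))
  show "starts_at_zero k (coord_walk_L k us vs) (coord_walk_R k us vs)"
    unfolding starts_at_zero_def coord_walk_L_def coord_walk_R_def coord_nth_0[OF assms(2,3)]
    by (simp add: map_replicate_const del: upt_Suc)
  show "steps (coord_walk_L k us vs) n = us" "steps (coord_walk_R k us vs) n = vs"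
    using assms(2,3)
    by (auto intro!: nth_equalityI simp: steps_def nth[of 0, simplified] partial_sums_nth_Suc)
qed

text \<open>
  The increments are lifted to integers, so that divisibility by \<open>3\<close> decides equality in the field.
\<close>

definition closes :: "nat \<Rightarrow> int list \<Rightarrow> int list \<Rightarrow> bool" where
  "closes k us vs \<longleftrightarrow> 3 dvd last (snd (coord us vs 0)) \<and>
     (\<forall>j\<in>set [0..<Suc k]. 3 dvd last (fst (coord us vs j)))"

lemma closed_walk_iff_closes:
  assumes "CARD('a::{field,finite}) = 3" "2 \<le> k"
    and "walk k n (l :: nat \<Rightarrow> 'a list) r" "starts_at_zero k l r"
    and "steps l n = map of_int us" "steps r n = map of_int vs"
  shows "closed_walk k n l r \<longleftrightarrow> closes k us vs"
proof -
  have len: "length us = n" "length vs = n"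
    using assms(5,6) by (metis length_map length_steps)+
  have co: "of_int (last (fst (coord us vs j))) = l n ! j"
    "of_int (last (snd (coord us vs j))) = r n ! j" if "j \<le> k" for j
  proof -
    have *: "coord (steps l n) (steps r n) j =
        map_prod (map of_int) (map of_int) (coord us vs j)"
      by (simp add: assms(5,6) map_of_int_coord)
    have "fst (coord us vs j) \<noteq> []" "snd (coord us vs j) \<noteq> []"
      using length_coord[OF len, of j] by auto
    then show "of_int (last (fst (coord us vs j))) = l n ! j"
      "of_int (last (snd (coord us vs j))) = r n ! j"
      using coord_walk[OF assms(2-4) that, of n] length_coord[OF len, of j]
      by (simp_all add: * last_conv_nth)
  qed
  have "closes k us vs \<longleftrightarrow> r n ! 0 = 0 \<and> (\<forall>j\<le>k. l n ! j = 0)"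
    unfolding closes_def of_int_eq_0_iff_3_dvd[OF assms(1), symmetric] set_upt
    by (simp add: co atLeast0LessThan lessThan_Suc_atMost Ball_def del: coord.simps)
  \<comment> \<open>Adjacency of the last pair: once \<open>l n\<close> and \<open>r n ! 0\<close>
    vanish, each product on the right-hand side has a zero factor, so the other right coordinates
    vanish too. Hence \<open>closes\<close> tests just one right coordinate.\<close>
  also have "\<dots> \<longleftrightarrow> (\<forall>j\<le>k. l n ! j = 0) \<and> (\<forall>j\<le>k. r n ! j = 0)"
  proof -
    have inc: "incident k (l n) (r n)" using assms(3) by (simp add: walk_def)
    have "r n ! j = 0" if "r n ! 0 = 0" "\<forall>j\<le>k. l n ! j = 0" "j \<le> k" for j
    proof (cases "j < 2")
      case True
      then show ?thesis using inc that(1) by (auto simp: less_2_cases_iff incident_def R_verts_def)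
    next
      case False
      then have "j \<in> {2..k}" using that by auto
      then show ?thesis using inc that unfolding incident_def by (fastforce split: if_splits)
    qed
    then show ?thesis by auto
  qed
  also have "\<dots> \<longleftrightarrow> l n = replicate (k + 1) 0 \<and> r n = replicate (k + 1) 0"
  proof -
    have "length (l n) = k + 1" "length (r n) = k + 1"
      using assms(3) by (auto simp: walk_def incident_def L_verts_def R_verts_def)
    then show ?thesis by (auto simp: list_eq_iff_nth_eq less_Suc_eq_le simp del: replicate_Suc)
  qed
  finally show ?thesis using assms(3,4) by (simp add: closed_walk_def starts_at_zero_def)
qed

section \<open>Moving an edge to the zero edge\<close>

text \<open>
  The automorphism moving a given edge to the zero edge is built one coordinate at a time. If
  the new coordinate \<open>j\<close> of left vertices is affine in old coordinates with index \<open>0, 1\<close> modulo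
  \<open>4\<close>, then by adjacency its product with \<open>r ! 0\<close> splits into a function of \<open>l\<close> and an affine
  function of \<open>r\<close>, whose coordinate indices are \<open>0\<close> or congruent to \<open>2, 3\<close>; these two summands
  yield the new coordinates \<open>j + 2\<close>. The other case is dual.
\<close>

inductive_set affine_span :: "nat set \<Rightarrow> ('a::{field,finite} list \<Rightarrow> 'a) set" for J where
  const: "(\<lambda>_. c) \<in> affine_span J"
| nth: "j \<in> J \<Longrightarrow> (\<lambda>v. v ! j) \<in> affine_span J"
| add: "a \<in> affine_span J \<Longrightarrow> b \<in> affine_span J \<Longrightarrow> (\<lambda>v. a v + b v) \<in> affine_span J"
| scale: "a \<in> affine_span J \<Longrightarrow> (\<lambda>v. c * a v) \<in> affine_span J"

lemma affine_span_diff_const: "a \<in> affine_span J \<Longrightarrow> (\<lambda>v. a v - c) \<in> affine_span J"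
  using affine_span.add[OF _ affine_span.const[of "- c"], of a] by simp

definition span_L :: "nat \<Rightarrow> ('a::{field,finite} list \<Rightarrow> 'a) set" where
  "span_L j = affine_span {m. m \<le> j \<and> m mod 4 < 2}"

definition span_R :: "nat \<Rightarrow> ('a::{field,finite} list \<Rightarrow> 'a) set" where
  "span_R j = affine_span {m. m \<le> j \<and> (m = 0 \<or> 2 \<le> m mod 4)}"

text \<open>Control is kept on \<open>q\<close> alone: coordinate \<open>j + 2\<close> is next
  multiplied through its right part, so \<open>p\<close> may be any function.\<close>

lemma mult_span_L:
  assumes "a \<in> span_L j" "j + 2 \<le> k"
  shows "\<exists>p. \<exists>q\<in>span_R (j + 2). \<forall>l r. incident k l r \<longrightarrow> r ! 0 * a l = p l + q r"
  using assms(1) unfolding span_L_def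
proof (induction rule: affine_span.induct)
  case (const c)
  have "(\<lambda>v. c * v ! 0) \<in> span_R (j + 2)"
    unfolding span_R_def by (intro affine_span.intros) auto
  then show ?case by (intro exI[of _ "\<lambda>_. 0"] bexI) auto
next
  case (nth m)
  have "(\<lambda>v. v ! (m + 2)) \<in> span_R (j + 2)"
    unfolding span_R_def by (intro affine_span.intros) (use nth in \<open>auto; presburger\<close>)
  moreover have "r ! 0 * l ! m = l ! (m + 2) + r ! (m + 2)" if "incident k l r" for l r :: "'a list"
    using that nth assms(2) by (auto simp: incident_iff)
  ultimately show ?case by (intro exI[of _ "\<lambda>v. v ! (m + 2)"] bexI) auto
next
  case (add a b)
  from add.IH(1) obtain p q where 1: "q \<in> span_R (j + 2)"
    "\<And>l r. incident k l r \<Longrightarrow> r ! 0 * a l = p l + q r" by blast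
  from add.IH(2) obtain p' q' where 2: "q' \<in> span_R (j + 2)"
    "\<And>l r. incident k l r \<Longrightarrow> r ! 0 * b l = p' l + q' r" by blast
  have "r ! 0 * (a l + b l) = (p l + p' l) + (q r + q' r)" if "incident k l r" for l r
    unfolding distrib_left 1(2)[OF that] 2(2)[OF that] by simp
  moreover have "(\<lambda>v. q v + q' v) \<in> span_R (j + 2)"
    using 1(1) 2(1) unfolding span_R_def by (rule affine_span.add)
  ultimately show ?case
    by (intro exI[of _ "\<lambda>v. p v + p' v"] bexI[of _ "\<lambda>v. q v + q' v"]) auto
next
  case (scale a c)
  then obtain p q where pq: "q \<in> span_R (j + 2)"
    "\<And>l r. incident k l r \<Longrightarrow> r ! 0 * a l = p l + q r" by blast
  have "r ! 0 * (c * a l) = c * p l + c * q r" if "incident k l r" for l r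
    using pq(2)[OF that] by (metis mult.left_commute distrib_left)
  moreover have "(\<lambda>v. c * q v) \<in> span_R (j + 2)"
    using pq(1) unfolding span_R_def by (rule affine_span.scale)
  ultimately show ?case
    by (intro exI[of _ "\<lambda>v. c * p v"] bexI[of _ "\<lambda>v. c * q v"]) auto
qed

lemma mult_span_R:
  assumes "b \<in> span_R j" "j + 2 \<le> k"
  shows "\<exists>p\<in>span_L (j + 2). \<exists>q. \<forall>l r. incident k l r \<longrightarrow> l ! 0 * b r = p l + q r"
  using assms(1) unfolding span_R_def
proof (induction rule: affine_span.induct)
  case (const c)
  have "(\<lambda>v. c * v ! 0) \<in> span_L (j + 2)"
    unfolding span_L_def by (intro affine_span.intros) auto
  then show ?case by (intro bexI exI[of _ "\<lambda>_. 0"]) auto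
next
  case (nth m)
  show ?case
  proof (cases "m = 0")
    case True
    \<comment> \<open>The product equals \<open>l ! 2 + r ! 2\<close>, and index 2 is not allowed in
      \<open>span_L\<close>; the condition \<open>l ! 1 = l ! 2\<close> replaces it by index
      1.\<close>
    have "(\<lambda>v. v ! 1) \<in> span_L (j + 2)"
      unfolding span_L_def by (intro affine_span.intros) auto
    moreover have "l ! 0 * r ! m = l ! 1 + r ! 2" if "incident k l r" for l r :: "'a list"
      using that True assms(2) by (auto simp: incident_def L_verts_def mult.commute)
    ultimately show ?thesis by (intro bexI exI[of _ "\<lambda>v. v ! 2"]) auto
  next
    case False
    have "(\<lambda>v. v ! (m + 2)) \<in> span_L (j + 2)"
      unfolding span_L_def by (intro affine_span.intros) (use nth False in \<open>auto; presburger\<close>)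
    moreover have "l ! 0 * r ! m = l ! (m + 2) + r ! (m + 2)" if "incident k l r" for l r :: "'a list"
      using that nth False assms(2) by (auto simp: incident_iff)
    ultimately show ?thesis by (intro bexI exI[of _ "\<lambda>v. v ! (m + 2)"]) auto
  qed
next
  case (add a b)
  from add.IH(1) obtain p q where 1: "p \<in> span_L (j + 2)"
    "\<And>l r. incident k l r \<Longrightarrow> l ! 0 * a r = p l + q r" by blast
  from add.IH(2) obtain p' q' where 2: "p' \<in> span_L (j + 2)"
    "\<And>l r. incident k l r \<Longrightarrow> l ! 0 * b r = p' l + q' r" by blast
  have "l ! 0 * (a r + b r) = (p l + p' l) + (q r + q' r)" if "incident k l r" for l r
    unfolding distrib_left 1(2)[OF that] 2(2)[OF that] by simp
  moreover have "(\<lambda>v. p v + p' v) \<in> span_L (j + 2)"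
    using 1(1) 2(1) unfolding span_L_def by (rule affine_span.add)
  ultimately show ?case
    by (intro bexI[of _ "\<lambda>v. p v + p' v"] exI[of _ "\<lambda>v. q v + q' v"]) auto
next
  case (scale a c)
  then obtain p q where pq: "p \<in> span_L (j + 2)"
    "\<And>l r. incident k l r \<Longrightarrow> l ! 0 * a r = p l + q r" by blast
  have "l ! 0 * (c * a r) = c * p l + c * q r" if "incident k l r" for l r
    using pq(2)[OF that] by (metis mult.left_commute distrib_left)
  moreover have "(\<lambda>v. c * p v) \<in> span_L (j + 2)"
    using pq(1) unfolding span_L_def by (rule affine_span.scale)
  ultimately show ?case
    by (intro bexI[of _ "\<lambda>v. c * p v"] exI[of _ "\<lambda>v. c * q v"]) auto
qed

text \<open>New coordinates 1 and 2 of left vertices must agree whenever the old ones do, so they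
  are given together and the induction starts at 2.\<close>

lemma edge_translation_coordinates:
  assumes inc: "incident k l0 r0" and "2 \<le> m" "m \<le> k"
  shows "\<exists>A B. A 0 = (\<lambda>l. l ! 0 - l0 ! 0) \<and> B 0 = (\<lambda>r. r ! 0 - r0 ! 0) \<and>
    B 1 = (\<lambda>_. 0) \<and> (\<forall>l. l ! 1 = l ! 2 \<longrightarrow> A 1 l = A 2 l) \<and>
    (\<forall>j\<le>m. A j l0 = 0 \<and> B j r0 = 0 \<and>
       (j mod 4 < 2 \<longrightarrow> A j \<in> span_L j) \<and> (2 \<le> j mod 4 \<longrightarrow> B j \<in> span_R j)) \<and>
    (\<forall>j l r. incident k l r \<longrightarrow> Suc (Suc j) \<le> m \<longrightarrow> A (Suc (Suc j)) l + B (Suc (Suc j)) r =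
        (if j mod 4 < 2 then B 0 r * A j l else A 0 l * B j r))"
  using assms(2,3)
proof (induction m rule: dec_induct)
  case base
  define x y where xy_def: "x = l0 ! 0" "y = r0 ! 0"
  \<comment> \<open>Found by expanding \<open>(l ! 0 - x) * (r ! 0 - y)\<close> with
    \<open>l ! 2 + r ! 2 = l ! 0 * r ! 0\<close>; the constants \<open>c\<close> and
    \<open>d\<close> make both parts vanish at the given edge.\<close>
  define c d where cd_def: "c = l0 ! 2 - x * y" "d = r0 ! 2 - x * y"
  define A where "A j = (if j = 0 then (\<lambda>l. l ! 0 - x) else (\<lambda>l. l ! j - y * l ! 0 - c))" for j :: nat
  define B where "B j = (if j = 0 then (\<lambda>r. r ! 0 - y) else
    if j = 1 then (\<lambda>_. 0) else (\<lambda>r. r ! j - x * r ! 0 - d))" for j :: nat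
  have 2: "l ! 2 + r ! 2 = l ! 0 * r ! 0" if "incident k l r" for l r :: "'a list"
    using that base by (auto simp: incident_def mult.commute)
  have l0: "l0 ! 1 = l0 ! 2" using inc by (auto simp: incident_def L_verts_def)
  have span: "(\<lambda>v. v ! j - z * v ! 0 - e) \<in> affine_span J" if "j \<in> J" "0 \<in> J" for z e :: 'a and j J
  proof -
    have "(\<lambda>v. v ! j + (- z) * v ! 0 - e) \<in> affine_span J"
      by (intro affine_span_diff_const affine_span.intros that)
    then show ?thesis by simp
  qed
  have "A 0 \<in> span_L 0" unfolding span_L_def A_def
    by (simp, intro affine_span_diff_const affine_span.intros) auto
  moreover have "A 1 \<in> span_L 1" unfolding span_L_def A_def by (simp add: span)
  moreover have "B 2 \<in> span_R 2" unfolding span_R_def B_def by (simp add: span)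
  moreover have "A 2 l + B 2 r = B 0 r * A 0 l" if "incident k l r" for l r
    using 2[OF that] 2[OF inc] by (simp add: A_def B_def cd_def xy_def algebra_simps)
  moreover have "A j l0 = 0" "B j r0 = 0" if "j \<le> 2" for j
    using that l0 by (auto simp: A_def B_def cd_def xy_def le_Suc_eq numeral_2_eq_2)
  ultimately show ?case
    by (intro exI[of _ A] exI[of _ B])
       (auto simp: le_Suc_eq numeral_2_eq_2 A_def B_def xy_def)
next
  case (step m)
  then obtain A B where AB: "A 0 = (\<lambda>l. l ! 0 - l0 ! 0)" "B 0 = (\<lambda>r. r ! 0 - r0 ! 0)"
    "B 1 = (\<lambda>_. 0)" "\<And>l. l ! 1 = l ! 2 \<Longrightarrow> A 1 l = A 2 l"
    and zero: "\<And>j. j \<le> m \<Longrightarrow> A j l0 = 0" "\<And>j. j \<le> m \<Longrightarrow> B j r0 = 0"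
    and span: "\<And>j. j \<le> m \<Longrightarrow> j mod 4 < 2 \<Longrightarrow> A j \<in> span_L j"
      "\<And>j. j \<le> m \<Longrightarrow> 2 \<le> j mod 4 \<Longrightarrow> B j \<in> span_R j"
    and eq: "\<And>j l r. incident k l r \<Longrightarrow> Suc (Suc j) \<le> m \<Longrightarrow> A (Suc (Suc j)) l + B (Suc (Suc j)) r =
        (if j mod 4 < 2 then B 0 r * A j l else A 0 l * B j r)"
    by force
  define j where "j = m - 1"
  have j: "m = Suc j" "1 \<le> j" using step by (auto simp: j_def)
  have "\<exists>a b. a l0 = 0 \<and> b r0 = 0 \<and> (Suc m mod 4 < 2 \<longrightarrow> a \<in> span_L (Suc m)) \<and>
      (2 \<le> Suc m mod 4 \<longrightarrow> b \<in> span_R (Suc m)) \<and>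
      (\<forall>l r. incident k l r \<longrightarrow> a l + b r = (if j mod 4 < 2 then B 0 r * A j l else A 0 l * B j r))"
  proof (cases "j mod 4 < 2")
    case True
    then have S: "2 \<le> Suc m mod 4" unfolding j(1) by presburger
    obtain p q where q: "q \<in> span_R (Suc m)"
      and pq: "\<And>l r. incident k l r \<Longrightarrow> r ! 0 * A j l = p l + q r"
      using mult_span_L[OF span(1)[of j], of k] True j step by auto
    have "(\<lambda>r. q r - (- p l0)) \<in> span_R (Suc m)"
      using q unfolding span_R_def by (rule affine_span_diff_const)
    \<comment> \<open>The product vanishes at the given edge, so the constants making both summands
      zero there cancel. Replacing \<open>r ! 0\<close> by \<open>B 0 r\<close> costs the extra term
      \<open>r0 ! 0 * A j l\<close>, which depends on \<open>l\<close> alone and joins the left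
      summand.\<close>
    moreover have "q r0 + p l0 = 0" using pq[OF inc] zero(1)[of j] j by (simp add: add.commute)
    ultimately show ?thesis using S True pq zero(1)[of j] j
      by (intro exI[of _ "\<lambda>l. p l - r0 ! 0 * A j l - p l0"] exI[of _ "\<lambda>r. q r + p l0"])
         (auto simp: AB algebra_simps)
  next
    case False
    then have S: "Suc m mod 4 < 2" unfolding j(1) by presburger
    obtain p q where p: "p \<in> span_L (Suc m)"
      and pq: "\<And>l r. incident k l r \<Longrightarrow> l ! 0 * B j r = p l + q r"
      using mult_span_R[OF span(2)[of j], of k] False j step by auto
    have "(\<lambda>l. p l - p l0) \<in> span_L (Suc m)"
      using p unfolding span_L_def by (rule affine_span_diff_const)
    moreover have "q r0 + p l0 = 0" using pq[OF inc] zero(2)[of j] j by (simp add: add.commute)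
    ultimately show ?thesis using S False pq zero(2)[of j] j
      by (intro exI[of _ "\<lambda>l. p l - p l0"] exI[of _ "\<lambda>r. q r - l0 ! 0 * B j r + p l0"])
         (auto simp: AB algebra_simps)
  qed
  then obtain a b where ab: "a l0 = 0" "b r0 = 0" "Suc m mod 4 < 2 \<Longrightarrow> a \<in> span_L (Suc m)"
      "2 \<le> Suc m mod 4 \<Longrightarrow> b \<in> span_R (Suc m)"
      "\<And>l r. incident k l r \<Longrightarrow> a l + b r = (if j mod 4 < 2 then B 0 r * A j l else A 0 l * B j r)"
    by blast
  show ?case
    using AB zero span eq ab j
    by (intro exI[of _ "A(Suc m := a)"] exI[of _ "B(Suc m := b)"]) (auto simp: le_Suc_eq)
qed

text \<open>Preservation of adjacency suffices to transport closed walks, so bijectivity is not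
  claimed. Translating coordinate 0 leaves all increments unchanged.\<close>

lemma edge_translation:
  assumes "2 \<le> k" "incident k l0 r0"
  obtains f g where "f l0 = replicate (k + 1) 0" "g r0 = replicate (k + 1) 0"
    "\<And>l r. incident k l r \<Longrightarrow> incident k (f l) (g r)"
    "\<And>l. f l ! 0 = l ! 0 - l0 ! 0" "\<And>r. g r ! 0 = r ! 0 - r0 ! 0"
proof -
  obtain A B where AB: "A 0 = (\<lambda>l. l ! 0 - l0 ! 0)" "B 0 = (\<lambda>r. r ! 0 - r0 ! 0)"
    "B 1 = (\<lambda>_. 0)" "\<And>l. l ! 1 = l ! 2 \<Longrightarrow> A 1 l = A 2 l"
    and zero: "\<And>j. j \<le> k \<Longrightarrow> A j l0 = 0" "\<And>j. j \<le> k \<Longrightarrow> B j r0 = 0"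
    and eq: "\<And>j l r. incident k l r \<Longrightarrow> Suc (Suc j) \<le> k \<Longrightarrow> A (Suc (Suc j)) l + B (Suc (Suc j)) r =
        (if j mod 4 < 2 then B 0 r * A j l else A 0 l * B j r)"
    using edge_translation_coordinates[OF assms(2,1) order.refl] by force
  define f where "f l = map (\<lambda>j. A j l) [0..<Suc k]" for l
  define g where "g r = map (\<lambda>j. B j r) [0..<Suc k]" for r
  have nth: "f l ! j = A j l" "g r ! j = B j r" if "j \<le> k" for j l r
    using that by (simp_all add: f_def g_def del: upt_Suc)
  have len: "length (f l) = k + 1" "length (g r) = k + 1" for l r
    by (simp_all add: f_def g_def)
  show thesis
  proof (rule that)
    show "f l0 = replicate (k + 1) 0" "g r0 = replicate (k + 1) 0"
      using nth zero len by (auto intro!: nth_equalityI simp del: replicate_Suc)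
    show "incident k (f l) (g r)" if "incident k l r" for l r
      using that eq[OF that] AB(3,4) assms(1)
      by (auto simp: incident_iff L_verts_def R_verts_def len nth)
    show "f l ! 0 = l ! 0 - l0 ! 0" "g r ! 0 = r ! 0 - r0 ! 0" for l r
      by (simp_all add: nth AB)
  qed
qed

lemma closed_walk_translate_to_zero:
  assumes "2 \<le> k" "closed_walk k n l r"
  obtains l' r' where "closed_walk k n l' r'" "starts_at_zero k l' r'"
    "steps l' n = steps l n" "steps r' n = steps r n"
proof -
  have "incident k (l 0) (r 0)" using assms(2) by (simp add: closed_walk_def walk_def)
  from edge_translation[OF assms(1) this] obtain f g where
    "f (l 0) = replicate (k + 1) 0" "g (r 0) = replicate (k + 1) 0"
    "\<And>l r. incident k l r \<Longrightarrow> incident k (f l) (g r)"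
    "\<And>v. f v ! 0 = v ! 0 - l 0 ! 0" "\<And>v. g v ! 0 = v ! 0 - r 0 ! 0" by blast
  then show thesis
    using assms(2) by (intro that[of "f \<circ> l" "g \<circ> r"])
      (simp_all add: closed_walk_def walk_def starts_at_zero_def steps_def)
qed

section \<open>Cycles and closed walks\<close>

text \<open>The remaining coordinates follow recursively from adjacency. Consequently a zero
  increment means that the walk backtracks.\<close>

lemma incident_L_unique:
  assumes "2 \<le> k" "incident k l r" "incident k l' r" "l ! 0 = l' ! 0"
  shows "l = l'"
proof (rule nth_equalityI)
  show "length l = length l'"
    using assms(2,3) by (simp add: incident_def L_verts_def)
  have eq: "l ! Suc (Suc j) + r ! Suc (Suc j) = (if j mod 4 < 2 then r ! 0 * l ! j else l ! 0 * r ! j)"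
    "l' ! Suc (Suc j) + r ! Suc (Suc j) = (if j mod 4 < 2 then r ! 0 * l' ! j else l' ! 0 * r ! j)"
    if "Suc (Suc j) \<le> k" for j
    using assms(2,3) that unfolding incident_iff by blast+
  have step: "l ! Suc (Suc j) = l' ! Suc (Suc j)" if "Suc (Suc j) \<le> k" "l ! j = l' ! j" for j
    using eq[OF that(1)] that(2) assms(4) by (metis add_right_cancel)
  fix j assume "j < length l"
  then have "j \<le> k" using assms(2) by (simp add: incident_def L_verts_def)
  from assms(1) _ _ _ _ this show "l ! j = l' ! j"
  proof (rule vertex_index_induct)
    show "l ! 2 = l' ! 2" using step[of 0] assms(1,4) by (simp add: numeral_2_eq_2)
    show "l ! 1 = l' ! 1" if "l ! 2 = l' ! 2"
      using that assms(2,3) by (simp add: incident_def L_verts_def)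
  qed (use step assms(4) in auto)
qed

lemma incident_R_unique:
  assumes "2 \<le> k" "incident k l r" "incident k l r'" "r ! 0 = r' ! 0"
  shows "r = r'"
proof (rule nth_equalityI)
  show "length r = length r'"
    using assms(2,3) by (simp add: incident_def R_verts_def)
  have eq: "l ! Suc (Suc j) + r ! Suc (Suc j) = (if j mod 4 < 2 then r ! 0 * l ! j else l ! 0 * r ! j)"
    "l ! Suc (Suc j) + r' ! Suc (Suc j) = (if j mod 4 < 2 then r' ! 0 * l ! j else l ! 0 * r' ! j)"
    if "Suc (Suc j) \<le> k" for j
    using assms(2,3) that unfolding incident_iff by blast+
  have step: "r ! Suc (Suc j) = r' ! Suc (Suc j)" if "Suc (Suc j) \<le> k" "r ! j = r' ! j" for j
    using eq[OF that(1)] that(2) assms(4) by (metis add_left_cancel)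
  fix j assume "j < length r"
  then have "j \<le> k" using assms(2) by (simp add: incident_def R_verts_def)
  from assms(1) _ _ _ _ this show "r ! j = r' ! j"
  proof (rule vertex_index_induct)
    show "r ! 2 = r' ! 2" using step[of 0] assms(1,4) by (simp add: numeral_2_eq_2)
    show "r ! 1 = r' ! 1"
      using assms(2,3) by (simp add: incident_def R_verts_def)
  qed (use step assms(4) in auto)
qed

section \<open>Cycles as arc lists and as vertex sequences\<close>

lemma parcs_Lambda_iff [simp]:
  "(Inl l, Inr r) \<in> parcs (Lambda k) \<longleftrightarrow> incident k l r"
  "(Inr r, Inl l) \<in> parcs (Lambda k) \<longleftrightarrow> incident k l r"
  "(Inl l, Inl l') \<notin> parcs (Lambda k)"
  "(Inr r, Inr r') \<notin> parcs (Lambda k)"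
  by (auto simp: Lambda_def)

lemma pverts_Lambda_if_incident: "incident k l r \<Longrightarrow> Inl l \<in> pverts (Lambda k)"
  by (auto simp: Lambda_def incident_def)

lemma pcas_vertex_sequence:
  assumes "pcas u p v"
  shows "pawalk_verts u p = map fst p @ [v]" "(map fst p @ [v]) ! 0 = u"
    "i < length p \<Longrightarrow> snd (p ! i) = (map fst p @ [v]) ! Suc i"
proof -
  have "pawalk_verts u p = map fst p @ [v] \<and> (map fst p @ [v]) ! 0 = u \<and>
      (\<forall>i<length p. snd (p ! i) = (map fst p @ [v]) ! Suc i)"
    using assms
    by (induction u p v rule: pcas.induct) (auto simp: nth_Cons split: nat.splits)
  then show "pawalk_verts u p = map fst p @ [v]" "(map fst p @ [v]) ! 0 = u"
    "i < length p \<Longrightarrow> snd (p ! i) = (map fst p @ [v]) ! Suc i" by auto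
qed

lemma cycle_with_proj_iff:
  "pre_digraph.cycle (with_proj G) p \<longleftrightarrow>
     (\<exists>u. u \<in> pverts G \<and> set p \<subseteq> parcs G \<and> pcas u p u \<and> distinct (tl (pawalk_verts u p)) \<and> p \<noteq> [])"
  by (simp add: pre_digraph.cycle_def pre_digraph.awalk_def cas_with_proj_eq awalk_verts_with_proj_eq)

text \<open>A cycle may begin in either vertex class. A periodic sequence can be shifted freely, so
  that it starts on the left.\<close>

lemma periodic_sequence_of_cycle:
  assumes "pre_digraph.cycle (with_proj G) p"
  obtains w where "\<And>i. (w i, w (Suc i)) \<in> parcs G"
    "\<And>i j. w i = w j \<longleftrightarrow> i mod length p = j mod length p"
proof -
  let ?m = "length p"
  from assms obtain u where p: "set p \<subseteq> parcs G" "pcas u p u"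
    "distinct (tl (pawalk_verts u p))" "p \<noteq> []"
    unfolding cycle_with_proj_iff by blast
  note seq = pcas_vertex_sequence[OF p(2)]
  define w where "w i = fst (p ! (i mod ?m))" for i
  have m: "0 < ?m" using p(4) by simp
  have u: "fst (p ! 0) = u" using seq(2) p(4) by (simp add: nth_append)
  have dist: "distinct (map fst p)"
    using p(3,4) u unfolding seq(1) by (cases p) auto
  show thesis
  proof (rule that)
    fix i j
    have "snd (p ! (i mod ?m)) = w (Suc i)"
      using seq(3)[of "i mod ?m"] m u Suc_leI[OF mod_less_divisor[OF m], of i] by (auto simp: w_def nth_append mod_Suc)
    moreover have "p ! (i mod ?m) \<in> parcs G" using p(1) m by auto
    ultimately show "(w i, w (Suc i)) \<in> parcs G"
      unfolding w_def by (metis prod.collapse)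
    show "w i = w j \<longleftrightarrow> i mod ?m = j mod ?m"
      using nth_eq_iff_index_eq[OF dist, of "i mod ?m" "j mod ?m"] m by (simp add: w_def)
  qed
qed

lemma cycle_of_vertex_sequence:
  assumes "0 < m" "\<And>i. i < m \<Longrightarrow> (w i, w (Suc i)) \<in> parcs G"
    and "inj_on w {..<m}" "w m = w 0" "w 0 \<in> pverts G"
  shows "pre_digraph.cycle (with_proj G) (map (\<lambda>i. (w i, w (Suc i))) [0..<m])"
proof -
  \<comment> \<open>Stated for arbitrary segments because the induction removes the first
    arc.\<close>
  have *: "pcas (w i) (map (\<lambda>i. (w i, w (Suc i))) [i..<i + d]) (w (i + d)) \<and>
     pawalk_verts (w i) (map (\<lambda>i. (w i, w (Suc i))) [i..<i + d]) = map w [i..<Suc (i + d)]" for i d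
  proof (induction d arbitrary: i)
    case (Suc d)
    show ?case using Suc[of "Suc i"] by (simp add: upt_conv_Cons del: upt_Suc)
  qed simp
  have "distinct (tl (map w [0..<Suc m]))"
  proof -
    have "tl [0..<Suc m] = [1..<m] @ [m]"
      using assms(1) upt_Suc_append[of 1 m]
      by (simp add: upt_conv_Cons[of 0] Suc_le_eq del: upt_Suc)
    then have "tl (map w [0..<Suc m]) = map w [1..<m] @ [w 0]"
      by (simp add: map_tl[symmetric] assms(4) del: upt_Suc)
    moreover have "inj_on w (insert 0 {1..<m})"
      by (rule inj_on_subset[OF assms(3)]) (use assms(1) in auto)
    ultimately show ?thesis
      by (auto simp: distinct_map dest: inj_on_subset[of _ _ "{1..<m}"])
  qed
  then show ?thesis
    using *[of 0 m] assms unfolding cycle_with_proj_iff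
    by (intro exI[of _ "w 0"]) auto
qed

lemma closed_walk_of_cycle:
  fixes p :: "(('a::{field,finite} list + 'a list) \<times> ('a list + 'a list)) list"
  assumes "2 \<le> k" "pre_digraph.cycle (with_proj (Lambda k)) p" "3 \<le> length p"
  obtains n and l r :: "nat \<Rightarrow> 'a list"
  where "length p = 2 * n" "2 \<le> n" "closed_walk k n l r"
    "0 \<notin> set (steps l n)" "0 \<notin> set (steps r n)"
proof -
  obtain w :: "nat \<Rightarrow> 'a list + 'a list" where w: "\<And>i. (w i, w (Suc i)) \<in> parcs (Lambda k)"
    "\<And>i j. w i = w j \<longleftrightarrow> i mod length p = j mod length p" and "isl (w 0)"
  proof -
    obtain w :: "nat \<Rightarrow> 'a list + 'a list" where w: "\<And>i. (w i, w (Suc i)) \<in> parcs (Lambda k)"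
      "\<And>i j. w i = w j \<longleftrightarrow> i mod length p = j mod length p"
      by (rule periodic_sequence_of_cycle[OF assms(2)]) (rule that; assumption)
    show thesis
    proof (cases "isl (w 0)")
      case True
      with w that show thesis by blast
    next
      case False
      \<comment> \<open>The cycle starts on the right; shifting by one position moves the start to
        the left class.\<close>
      then have "isl (w 1)" using w(1)[of 0] by (cases "w 0"; cases "w 1") auto
      moreover have "Suc i mod length p = Suc j mod length p \<longleftrightarrow> i mod length p = j mod length p" for i j
        unfolding nat_mod_eq_iff by simp
      ultimately show thesis
        using w(1) by (intro that[of "\<lambda>i. w (Suc i)"]) (simp_all add: w(2))
    qed
  qed
  have side: "isl (w i) \<longleftrightarrow> even i" for i
  proof (induction i)
    case (Suc i)
    then show ?case using w(1)[of i] by (cases "w i"; cases "w (Suc i)") auto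
  qed (use \<open>isl (w 0)\<close> in auto)
  have "w (length p) = w 0" using w(2) by simp
  then have "even (length p)" using side[of 0] side[of "length p"] by simp
  then obtain n where n: "length p = 2 * n" by blast
  define l r where "l i = projl (w (2 * i))" and "r i = projr (w (2 * i + 1))" for i
  have lr: "w (2 * i) = Inl (l i)" "w (Suc (2 * i)) = Inr (r i)" for i
    using side[of "2 * i"] side[of "2 * i + 1"]
    by (auto simp: l_def r_def sum.collapse(2))
  have inc: "incident k (l i) (r i)" "incident k (l (Suc i)) (r i)" for i
    using w(1)[of "2 * i"] w(1)[of "Suc (2 * i)"] lr[of i] lr(1)[of "Suc i"] by auto
  \<comment> \<open>This is where the bound 3 on the length enters: \<open>2 * n\<close> does not
    divide 2, so the cycle does not backtrack.\<close>
  have two: "Suc (Suc i) mod (2 * n) \<noteq> i mod (2 * n)" for i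
  proof
    assume "Suc (Suc i) mod (2 * n) = i mod (2 * n)"
    then have "2 * n dvd 2" by (simp add: mod_eq_dvd_iff_nat)
    then show False using n assms(3) by (auto dest: dvd_imp_le)
  qed
  show thesis
  proof (rule that[of n l r])
    show "2 \<le> n" using n assms(3) by simp
    have "w (2 * n) = w 0" "w (Suc (2 * n)) = w 1" using w(2) n by (auto simp: mod_Suc)
    then show "closed_walk k n l r"
      using inc by (simp add: closed_walk_def walk_def l_def r_def)
    have "l (Suc i) ! 0 \<noteq> l i ! 0" for i
    proof
      assume "l (Suc i) ! 0 = l i ! 0"
      then have "l (Suc i) = l i" using incident_L_unique[OF assms(1)] inc by blast
      then have "w (2 * Suc i) = w (2 * i)" unfolding lr by simp
      then show False using two[of "2 * i"] w(2) n by simp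
    qed
    then show "0 \<notin> set (steps l n)" by (auto simp: steps_def)
    have "r (Suc i) ! 0 \<noteq> r i ! 0" for i
    proof
      assume "r (Suc i) ! 0 = r i ! 0"
      then have "r (Suc i) = r i" using incident_R_unique[OF assms(1)] inc by blast
      then have "w (Suc (2 * Suc i)) = w (Suc (2 * i))" unfolding lr by simp
      then show False using two[of "Suc (2 * i)"] w(2) n by simp
    qed
    then show "0 \<notin> set (steps r n)" by (auto simp: steps_def)
  qed (rule n)
qed

lemma cycle_of_closed_walk:
  fixes l r :: "nat \<Rightarrow> 'a::{field,finite} list"
  assumes "closed_walk k n l r" "0 < n" "inj_on l {..<n}" "inj_on r {..<n}"
  obtains p where "pre_digraph.cycle (with_proj (Lambda k :: ('a list + 'a list) pair_pre_digraph)) p"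
    "length p = 2 * n"
proof -
  define w where "w i = (if even i then Inl (l (i div 2)) else Inr (r (i div 2)))" for i
  have "(w i, w (Suc i)) \<in> parcs (Lambda k)" if "i < 2 * n" for i
  proof (cases "even i")
    case True
    then obtain j where "i = 2 * j" by blast
    then show ?thesis
      using that assms(1) by (auto simp: w_def closed_walk_def walk_def)
  next
    case False
    then obtain j where "i = 2 * j + 1" by (rule oddE)
    then show ?thesis
      using that assms(1) by (auto simp: w_def closed_walk_def walk_def)
  qed
  moreover have "inj_on w {..<2 * n}"
  proof (rule inj_onI)
    fix i j assume "i \<in> {..<2 * n}" "j \<in> {..<2 * n}" and eq: "w i = w j"
    then have "i div 2 \<in> {..<n}" "j div 2 \<in> {..<n}" by auto
    then have "i div 2 = j div 2" and "even i \<longleftrightarrow> even j"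
      using eq inj_onD[OF assms(3)] inj_onD[OF assms(4)] by (auto simp: w_def split: if_splits)
    then show "i = j" by (metis bit_eq_rec)
  qed
  moreover have "w (2 * n) = w 0" using assms(1) by (simp add: w_def closed_walk_def)
  moreover have "w 0 \<in> pverts (Lambda k)"
    using assms(1) pverts_Lambda_if_incident[of k "l 0" "r 0"]
    by (simp add: w_def closed_walk_def walk_def)
  ultimately show thesis
    using cycle_of_vertex_sequence[of "2 * n" w "Lambda k"] assms(2) by (intro that) auto
qed

section \<open>Types as interleaved increments\<close>

definition riffle :: "'a list \<Rightarrow> 'a list \<Rightarrow> 'a list" where
  "riffle us vs = concat (map2 (\<lambda>u v. [u, v]) us vs)"

lemma riffle_steps: "riffle (steps l n) (steps r n) =
    concat (map (\<lambda>i. [l (Suc i) ! 0 - l i ! 0, r (Suc i) ! 0 - r i ! 0]) [0..<n])"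
  by (simp add: riffle_def steps_def zip_map_map comp_def split_def zip_same_conv_map)

lemma has_cycle_of_type_iff:
  "has_cycle_of_type k \<epsilon> \<longleftrightarrow> (\<exists>n l r. 2 \<le> n \<and> closed_walk k n l r \<and> starts_at_zero k l r \<and>
     inj_on l {..<n} \<and> inj_on r {..<n} \<and> riffle (steps l n) (steps r n) = \<epsilon>)"
proof
  assume "has_cycle_of_type k \<epsilon>"
  then obtain n l r where c: "cycle_through_zero k n l r" and t: "cycle_type n l r = \<epsilon>"
    unfolding has_cycle_of_type_def by blast
  \<comment> \<open>Reduction modulo \<open>n\<close> makes index \<open>n\<close> return to the
    first vertex, as \<open>closed_walk\<close> demands.\<close>
  define l' r' where "l' i = l (Suc (i mod n))" and "r' i = r (Suc (i mod n))" for i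
  have n: "2 \<le> n" using c by (simp add: cycle_through_zero_def)
  have zero: "l 1 = replicate (k + 1) 0" "r 1 = replicate (k + 1) 0"
    using c by (simp_all add: cycle_through_zero_def)
  have inc: "incident k (l i) (r i)" if "i \<in> {1..n}" for i
    using c that by (simp add: cycle_through_zero_def)
  have inc': "incident k (l (Suc (Suc i mod n))) (r (Suc i))" if "i < n" for i
  proof (cases "Suc i = n")
    case True
    have "incident k (l 1) (r n)"
      using c unfolding cycle_through_zero_def parcs_Lambda_iff by blast
    then show ?thesis using True by simp
  next
    case False
    then have "Suc i \<in> {1..<n}" using that by auto
    then show ?thesis using c that False by (auto simp: cycle_through_zero_def)
  qed
  have inj_shift: "inj_on (\<lambda>i. f (Suc (i mod n))) {..<n}" if "inj_on f {1..n}"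
    for f :: "nat \<Rightarrow> 'a list"
  proof (rule inj_onI)
    fix i j assume ij: "i \<in> {..<n}" "j \<in> {..<n}" "f (Suc (i mod n)) = f (Suc (j mod n))"
    then have "Suc i = Suc j" by (intro inj_onD[OF that]) auto
    then show "i = j" by simp
  qed
  have "closed_walk k n l' r'"
    unfolding closed_walk_def walk_def l'_def r'_def using n inc inc' by (auto simp: Suc_le_eq)
  moreover have "starts_at_zero k l' r'"
    using zero by (simp add: starts_at_zero_def l'_def r'_def)
  moreover have "inj_on l' {..<n}" "inj_on r' {..<n}"
    using c unfolding cycle_through_zero_def l'_def r'_def by (blast intro: inj_shift)+
  moreover have "riffle (steps l' n) (steps r' n) = \<epsilon>"
  proof -
    \<comment> \<open>The value 0 that \<open>cycle_type\<close> puts at position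
      \<open>n + 1\<close> is the 0-th coordinate of the first vertex, so it agrees with the
      wrap-around in \<open>l'\<close> and \<open>r'\<close>.\<close>
    have "\<epsilon> = concat (map (\<lambda>i. [(if i = n then 0 else l (Suc i) ! 0) - (if i = n + 1 then 0 else l i ! 0),
        (if i = n then 0 else r (Suc i) ! 0) - (if i = n + 1 then 0 else r i ! 0)]) (map Suc [0..<n]))"
      unfolding t[symmetric] cycle_type_def Let_def map_Suc_upt Suc_eq_plus1
      by (simp del: upt_Suc)
    also have "\<dots> = riffle (steps l' n) (steps r' n)"
      unfolding riffle_steps map_map
      by (rule arg_cong[where f = concat], rule map_cong)
         (use zero n in \<open>simp_all add: l'_def r'_def mod_Suc\<close>)
    finally show ?thesis by simp
  qed
  ultimately show "\<exists>n l r. 2 \<le> n \<and> closed_walk k n l r \<and> starts_at_zero k l r \<and>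
     inj_on l {..<n} \<and> inj_on r {..<n} \<and> riffle (steps l n) (steps r n) = \<epsilon>" using n by blast
next
  assume "\<exists>n l r. 2 \<le> n \<and> closed_walk k n l r \<and> starts_at_zero k l r \<and>
     inj_on l {..<n} \<and> inj_on r {..<n} \<and> riffle (steps l n) (steps r n) = \<epsilon>"
  then obtain n l r where n: "2 \<le> n" and w: "closed_walk k n l r" "starts_at_zero k l r"
    and inj: "inj_on l {..<n}" "inj_on r {..<n}" and t: "riffle (steps l n) (steps r n) = \<epsilon>" by blast
  define l' r' where "l' i = l (i - 1)" and "r' i = r (i - 1)" for i
  have inj_pred: "inj_on (\<lambda>i. f (i - 1)) {1..n}" if "inj_on f {..<n}" for f :: "nat \<Rightarrow> 'a list"
  proof (rule inj_onI)
    fix i j assume "i \<in> {1..n}" "j \<in> {1..n}" "f (i - 1) = f (j - 1)"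
    then have "i - 1 = j - 1" by (intro inj_onD[OF that]) auto
    then show "i = j" using \<open>i \<in> {1..n}\<close> \<open>j \<in> {1..n}\<close> by auto
  qed
  have "cycle_through_zero k n l' r'"
    unfolding cycle_through_zero_def
  proof (intro conjI ballI)
    show "inj_on l' {1..n}" "inj_on r' {1..n}"
      unfolding l'_def r'_def by (rule inj_pred[OF inj(1)], rule inj_pred[OF inj(2)])
    show "(Inl (l' i), Inr (r' i)) \<in> parcs (Lambda k)" if "i \<in> {1..n}" for i
      using that w(1) by (auto simp: l'_def r'_def closed_walk_def walk_def)
    show "(Inr (r' i), Inl (l' (i + 1))) \<in> parcs (Lambda k)" if "i \<in> {1..<n}" for i
    proof -
      have "i \<noteq> 0" using that by auto
      then obtain j where "i = Suc j" by (cases i) auto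
      then show ?thesis using that w(1) by (auto simp: l'_def r'_def closed_walk_def walk_def)
    qed
    obtain j where "n = Suc j" using n by (cases n) auto
    then show "(Inr (r' n), Inl (l' 1)) \<in> parcs (Lambda k)"
      using w(1) by (auto simp: l'_def r'_def closed_walk_def walk_def)
  qed (use n w(2) in \<open>auto simp: l'_def r'_def starts_at_zero_def\<close>)
  moreover have "cycle_type n l' r' = \<epsilon>"
  proof -
    have z: "l n ! 0 = 0" "r n ! 0 = 0"
      using w by (auto simp: closed_walk_def starts_at_zero_def)
    have "cycle_type n l' r' = concat (map (\<lambda>i. [(if i = n then 0 else l' (Suc i) ! 0) - (if i = n + 1 then 0 else l' i ! 0),
        (if i = n then 0 else r' (Suc i) ! 0) - (if i = n + 1 then 0 else r' i ! 0)]) (map Suc [0..<n]))"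
      unfolding cycle_type_def Let_def map_Suc_upt Suc_eq_plus1
      by (simp del: upt_Suc)
    also have "\<dots> = riffle (steps l n) (steps r n)"
      unfolding riffle_steps map_map
      by (rule arg_cong[where f = concat], rule map_cong)
         (use z in \<open>auto simp: l'_def r'_def\<close>)
    finally show ?thesis using t by simp
  qed
  ultimately show "has_cycle_of_type k \<epsilon>" unfolding has_cycle_of_type_def by blast
qed

fun evens :: "'a list \<Rightarrow> 'a list" where
  "evens (x # y # zs) = x # evens zs"
| "evens zs = zs"

fun odds :: "'a list \<Rightarrow> 'a list" where
  "odds (x # y # zs) = y # odds zs"
| "odds zs = []"

lemma evens_odds_riffle [simp]:
  assumes "length us = length vs"
  shows "evens (riffle us vs) = us" "odds (riffle us vs) = vs"
  using assms by (induction us vs rule: list_induct2) (simp_all add: riffle_def)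

lemma riffle_evens_odds:
  "even (length zs) \<Longrightarrow> riffle (evens zs) (odds zs) = zs \<and> length (evens zs) = length zs div 2 \<and>
     length (odds zs) = length zs div 2"
  by (induction zs rule: evens.induct) (auto simp: riffle_def)

lemma length_riffle [simp]: "length us = length vs \<Longrightarrow> length (riffle us vs) = 2 * length vs"
  by (induction us vs rule: list_induct2) (simp_all add: riffle_def)

lemma set_riffle [simp]: "length us = length vs \<Longrightarrow> set (riffle us vs) = set us \<union> set vs"
  by (induction us vs rule: list_induct2) (auto simp add: riffle_def)

lemma map_riffle: "map f (riffle us vs) = riffle (map f us) (map f vs)"
  by (simp add: riffle_def map_concat zip_map_map split_def comp_def)

section \<open>Enumeration of the closed walks\<close>

text \<open>Closing in coordinate 0 is a condition on each half separately. Filtering before the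
  halves are paired leaves 484 pairs for \<open>n = 6\<close>.\<close>

definition zero_sum_signs :: "nat \<Rightarrow> int list list" where
  "zero_sum_signs n = filter (\<lambda>us. 3 dvd sum_list us) (List.n_lists n signs)"

text \<open>The families of the theorem with integer entries; \<open>3 dvd\<close> stands for
  vanishing in the field. The default \<open>[]\<close> is meant for \<open>k = 9\<close>, where no
  word of length 12 closes.\<close>

definition types :: "nat \<Rightarrow> int list list" where
  "types k =
    (if k = 4 then
       [e. a \<leftarrow> signs, b \<leftarrow> signs, c \<leftarrow> signs, r \<leftarrow> signs, e \<leftarrow>
        [[a, r, b, -r, a, r, b, -r, a, r, b, -r],
         [a, r, b, -r, -a, -r, -a, -r, -b, r, a, r],
         [a, r, a, r, c, -r, -a, -r, -a, -r, -c, r],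
         [a, r, b, r, b, r, -a, -r, -b, -r, -b, -r],
         [a, r, -a, r, a, r, -a, r, a, r, -a, r]]]
     else if k = 5 \<or> k = 6 then
       [[a, c, b, d, a, c, b, d, a, c, b, d].
        a \<leftarrow> signs, b \<leftarrow> signs, c \<leftarrow> signs, d \<leftarrow> signs, 3 dvd (a + b) * (c + d)]
     else if k = 7 then
       [[a, c, b, -c, a, c, b, -c, a, c, b, -c]. a \<leftarrow> signs, b \<leftarrow> signs, c \<leftarrow> signs]
     else if k = 8 then
       [[a, c, -a, -c, a, c, -a, -c, a, c, -a, -c]. a \<leftarrow> signs, c \<leftarrow> signs]
     else [])"

text \<open>
  Coordinates \<open>0, ..., 4\<close> already separate the vertices of each of these cycles.
\<close>

definition vertices_mod_3 :: "(int list \<times> int list \<Rightarrow> int list) \<Rightarrow> nat \<Rightarrow> int list \<Rightarrow> int list \<Rightarrow> int list list" where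
  "vertices_mod_3 f n us vs =
     (\<lambda>cs. map (\<lambda>i. map (\<lambda>c. c ! i mod 3) cs) [0..<n]) (map (\<lambda>j. f (coord us vs j)) [0..<5])"

text \<open>Testing \<open>k = 4\<close> covers all larger \<open>k\<close>, by
  \<open>closes_mono\<close>.\<close>

lemma not_closes_if_less_6:
  "\<forall>n\<in>set [2..<6]. \<forall>us\<in>set (zero_sum_signs n). \<forall>vs\<in>set (zero_sum_signs n). \<not> closes 4 us vs"
  by code_simp

lemma closes_4_imp_types:
  "\<forall>us\<in>set (zero_sum_signs 6). \<forall>vs\<in>set (zero_sum_signs 6).
     closes 4 us vs \<longrightarrow> riffle us vs \<in> set (types 4)"
  by code_simp

lemma closes_iff_types_if_types_4:
  "\<forall>e\<in>set (types 4). \<forall>k\<in>set [4..<10]. closes k (evens e) (odds e) \<longleftrightarrow> e \<in> set (types k)"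
  by code_simp

text \<open>Brings a word listed for larger \<open>k\<close> back among those for which closing has
  been evaluated.\<close>

lemma types_subset_types_4: "\<forall>k\<in>set [4..<9]. \<forall>e\<in>set (types k). e \<in> set (types 4)"
  by code_simp

text \<open>Closing does not by itself exclude repeated vertices; this check turns the closed walks
  of length 12 into cycles.\<close>

lemma distinct_vertices_mod_3:
  "\<forall>e\<in>set (types 4). distinct (vertices_mod_3 fst 6 (evens e) (odds e)) \<and>
     distinct (vertices_mod_3 snd 6 (evens e) (odds e))"
  by code_simp

section \<open>From the computed words to cycles in the graph\<close>

lemma closes_iff:
  "closes k us vs \<longleftrightarrow> 3 dvd last (snd (coord us vs 0)) \<and> (\<forall>j\<le>k. 3 dvd last (fst (coord us vs j)))"
  unfolding closes_def set_upt atLeast0LessThan lessThan_Suc_atMost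
  by (simp add: Ball_def del: coord.simps)

lemma closes_mono: "closes k us vs \<Longrightarrow> j \<le> k \<Longrightarrow> closes j us vs"
  unfolding closes_iff by auto

lemma zero_sum_signs_if_closes:
  assumes "closes k us vs" "set us \<subseteq> set signs" "set vs \<subseteq> set signs"
    "length us = n" "length vs = n"
  shows "us \<in> set (zero_sum_signs n)" "vs \<in> set (zero_sum_signs n)"
proof -
  have "3 dvd last (fst (coord us vs 0))" "3 dvd last (snd (coord us vs 0))"
    using assms(1) unfolding closes_iff by blast+
  then show "us \<in> set (zero_sum_signs n)" "vs \<in> set (zero_sum_signs n)"
    using assms(2-5) by (simp_all add: zero_sum_signs_def set_n_lists last_partial_sums)
qed

lemma closes_iff_types:
  assumes "set us \<subseteq> set signs" "set vs \<subseteq> set signs" "length us = 6" "length vs = 6"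
    and "k \<in> {4..9}"
  shows "closes k us vs \<longleftrightarrow> riffle us vs \<in> set (types k)"
proof
  assume c: "closes k us vs"
  then have c4: "closes 4 us vs" using closes_mono assms(5) by auto
  have "riffle us vs \<in> set (types 4)"
    using closes_4_imp_types zero_sum_signs_if_closes[OF c4 assms(1-4)] c4 by blast
  then show "riffle us vs \<in> set (types k)"
    using closes_iff_types_if_types_4 c assms(3-5) evens_odds_riffle[of us vs] by fastforce
next
  assume t: "riffle us vs \<in> set (types k)"
  show "closes k us vs"
  proof (cases "k = 9")
    case True
    then show ?thesis using t by (simp add: types_def)
  next
    case False
    then have "k \<in> set [4..<9]" using assms(5) unfolding set_upt by auto
    then have "riffle us vs \<in> set (types 4)" using t types_subset_types_4 by blast
    then show ?thesis
      using closes_iff_types_if_types_4 t assms(3-5) evens_odds_riffle[of us vs] by fastforce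
  qed
qed

lemma inj_on_if_distinct_vertices_mod_3:
  assumes "CARD('a::{field,finite}) = 3" "4 \<le> k"
    and "walk k n (l :: nat \<Rightarrow> 'a list) r" "starts_at_zero k l r"
    and "steps l n = map of_int us" "steps r n = map of_int vs"
    and "m \<le> n" "distinct (vertices_mod_3 fst m us vs)" "distinct (vertices_mod_3 snd m us vs)"
  shows "inj_on l {..<m}" "inj_on r {..<m}"
proof -
  have len: "length us = n" "length vs = n"
    using assms(5,6) by (metis length_map length_steps)+
  have co: "of_int (fst (coord us vs j) ! i) = l i ! j" "of_int (snd (coord us vs j) ! i) = r i ! j"
    if "j < 5" "i < m" for i j
    using coord_walk[OF _ assms(3,4), of j i] length_coord[OF len, of j] assms(2,7) that
    by (simp_all add: assms(5,6) map_of_int_coord)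
  have inj: "inj_on w {..<m}" if w: "\<And>i j. j < 5 \<Longrightarrow> i < m \<Longrightarrow> of_int (f (coord us vs j) ! i) = (w i ! j :: 'a)"
    and "distinct (vertices_mod_3 f m us vs)" for w f
  proof (rule inj_onI)
    fix i i' assume i: "i \<in> {..<m}" "i' \<in> {..<m}" "w i = w i'"
    then have "f (coord us vs j) ! i mod 3 = f (coord us vs j) ! i' mod 3" if "j < 5" for j
      using w[of j i] w[of j i'] that of_int_eq_iff_mod_3[OF assms(1)] by (metis lessThan_iff)
    then have "vertices_mod_3 f m us vs ! i = vertices_mod_3 f m us vs ! i'"
      using i(1,2) by (simp add: vertices_mod_3_def)
    then show "i = i'"
      using i(1,2) that(2) nth_eq_iff_index_eq[of "vertices_mod_3 f m us vs" i i']
      by (simp add: vertices_mod_3_def)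
  qed
  show "inj_on l {..<m}" using co(1) assms(8) by (rule inj)
  show "inj_on r {..<m}" using co(2) assms(9) by (rule inj)
qed

lemma has_cycle_of_type_iff_types:
  fixes \<epsilon> :: "'a::{field,finite} list"
  assumes "CARD('a) = 3" "length \<epsilon> = 12" "0 \<notin> set \<epsilon>" "k \<in> {4..8}"
  shows "has_cycle_of_type k \<epsilon> \<longleftrightarrow> \<epsilon> \<in> map of_int ` set (types k)"
proof -
  obtain e where e: "\<epsilon> = map of_int e" "set e \<subseteq> set signs"
    using ex_signs_if_nonzero[OF assms(1,3)] by blast
  define us vs where "us = evens e" and "vs = odds e"
  have uv: "length us = 6" "length vs = 6" "riffle us vs = e"
    using riffle_evens_odds[of e] assms(2) e(1) by (simp_all add: us_def vs_def)
  have signs: "set us \<subseteq> set signs" "set vs \<subseteq> set signs"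
    using e(2) uv set_riffle[of us vs] by auto
  have k: "2 \<le> k" "4 \<le> k" "k \<in> {4..9}" using assms(4) by auto
  have "has_cycle_of_type k \<epsilon> \<longleftrightarrow> closes k us vs"
  proof
    assume "has_cycle_of_type k \<epsilon>"
    then obtain n l r where w: "closed_walk k n l r" "starts_at_zero k l r"
      and t: "riffle (steps l n) (steps r n) = \<epsilon>"
      unfolding has_cycle_of_type_iff by blast
    \<comment> \<open>\<open>has_cycle_of_type\<close> leaves the length open; the length of the
      type fixes it.\<close>
    have "n = 6" using arg_cong[OF t, of length] assms(2) by simp
    have "steps l n = evens \<epsilon>" "steps r n = odds \<epsilon>" using t by auto
    moreover have "evens \<epsilon> = map of_int us" "odds \<epsilon> = map of_int vs"
      using uv by (simp_all add: e(1) map_riffle flip: uv(3))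
    ultimately show "closes k us vs"
      using closed_walk_iff_closes[OF assms(1) k(1) _ w(2)] w(1) by (auto simp: closed_walk_def)
  next
    assume c: "closes k us vs"
    \<comment> \<open>Passing to \<open>k = 4\<close> makes the distinctness computation applicable
      for every \<open>k\<close> in the range.\<close>
    then have "e \<in> set (types 4)"
      using closes_iff_types[OF signs uv(1,2), of 4] closes_mono[OF c k(2)] uv(3) by simp
    then have d: "distinct (vertices_mod_3 fst 6 us vs)" "distinct (vertices_mod_3 snd 6 us vs)"
      using distinct_vertices_mod_3 by (auto simp: us_def vs_def)
    obtain l r :: "nat \<Rightarrow> 'a list" where w: "walk k 6 l r" "starts_at_zero k l r"
      "steps l 6 = map of_int us" "steps r 6 = map of_int vs"
      using walk_coord_walk[OF k(1), of "map of_int us" 6 "map of_int vs"] uv by auto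
    have "closed_walk k 6 l r" using closed_walk_iff_closes[OF assms(1) k(1) w] c by simp
    moreover have "inj_on l {..<6}" "inj_on r {..<6}"
      using inj_on_if_distinct_vertices_mod_3[OF assms(1) k(2) w order.refl d] by auto
    moreover have "riffle (steps l 6) (steps r 6) = \<epsilon>"
      unfolding w(3,4) e(1) uv(3)[symmetric] map_riffle ..
    ultimately show "has_cycle_of_type k \<epsilon>"
      using w(2) unfolding has_cycle_of_type_iff
      by (intro exI[of _ 6] exI[of _ l] exI[of _ r]) simp
  qed
  also have "\<dots> \<longleftrightarrow> e \<in> set (types k)"
    using closes_iff_types[OF signs uv(1,2) k(3)] uv(3) by simp
  also have "\<dots> \<longleftrightarrow> \<epsilon> \<in> map of_int ` set (types k)"
  proof -
    have "set (types k) \<subseteq> lists (set signs)"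
      by (auto simp: types_def signs_def)
    moreover have "e \<in> lists (set signs)" using e(2) by auto
    ultimately show ?thesis
      unfolding e(1) by (intro inj_on_image_mem_iff[OF inj_on_map_of_int_signs[OF assms(1)], symmetric])
  qed
  finally show ?thesis .
qed

text \<open>With the nonzero elements written as the image of \<open>signs\<close>, the unions have
  the same nesting as the list comprehensions, and \<open>of_int\<close> can be pushed
  inside.\<close>

lemma image_types:
  assumes "CARD('a::{field,finite}) = 3"
  shows "map of_int ` set (types 4) = (\<Union>a\<in>-{0::'a}. \<Union>b\<in>-{0}. \<Union>c\<in>-{0}. \<Union>r\<in>-{0}.
       {[a, r, b, -r, a, r, b, -r, a, r, b, -r],
        [a, r, b, -r, -a, -r, -a, -r, -b, r, a, r],
        [a, r, a, r, c, -r, -a, -r, -a, -r, -c, r],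
        [a, r, b, r, b, r, -a, -r, -b, -r, -b, -r],
        [a, r, -a, r, a, r, -a, r, a, r, -a, r]})"
    and "k = 5 \<or> k = 6 \<Longrightarrow> map of_int ` set (types k) =
       (\<Union>a\<in>-{0::'a}. \<Union>b\<in>-{0}. \<Union>c\<in>-{0}. \<Union>d\<in>-{0}.
          if (a + b) * (c + d) = 0 then {[a, c, b, d, a, c, b, d, a, c, b, d]} else {})"
    and "map of_int ` set (types 7) =
       (\<Union>a\<in>-{0::'a}. \<Union>b\<in>-{0}. \<Union>c\<in>-{0}. {[a, c, b, -c, a, c, b, -c, a, c, b, -c]})"
    and "map of_int ` set (types 8) =
       (\<Union>a\<in>-{0::'a}. \<Union>c\<in>-{0}. {[a, c, -a, -c, a, c, -a, -c, a, c, -a, -c]})"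
proof -
  note nz = nonzero_eq_image_signs[OF assms]
  show "map of_int ` set (types 4) = (\<Union>a\<in>-{0::'a}. \<Union>b\<in>-{0}. \<Union>c\<in>-{0}. \<Union>r\<in>-{0}.
       {[a, r, b, -r, a, r, b, -r, a, r, b, -r],
        [a, r, b, -r, -a, -r, -a, -r, -b, r, a, r],
        [a, r, a, r, c, -r, -a, -r, -a, -r, -c, r],
        [a, r, b, r, b, r, -a, -r, -b, -r, -b, -r],
        [a, r, -a, r, a, r, -a, r, a, r, -a, r]})"
    unfolding nz types_def by (simp add: image_UN)
  show "map of_int ` set (types 7) =
       (\<Union>a\<in>-{0::'a}. \<Union>b\<in>-{0}. \<Union>c\<in>-{0}. {[a, c, b, -c, a, c, b, -c, a, c, b, -c]})"
    unfolding nz types_def by (simp add: image_UN image_image UNION_singleton_eq_range)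
  show "map of_int ` set (types 8) =
       (\<Union>a\<in>-{0::'a}. \<Union>c\<in>-{0}. {[a, c, -a, -c, a, c, -a, -c, a, c, -a, -c]})"
    unfolding nz types_def by (simp add: image_UN image_image UNION_singleton_eq_range)
  have zero: "3 dvd (a + b) * (c + d) \<longleftrightarrow> (of_int a + of_int b) * (of_int c + of_int d) = (0::'a)"
    for a b c d :: int
    unfolding of_int_eq_0_iff_3_dvd[OF assms, symmetric] by simp
  show "map of_int ` set (types k) = (\<Union>a\<in>-{0::'a}. \<Union>b\<in>-{0}. \<Union>c\<in>-{0}. \<Union>d\<in>-{0}.
      if (a + b) * (c + d) = 0 then {[a, c, b, d, a, c, b, d, a, c, b, d]} else {})"
    if "k = 5 \<or> k = 6"
  proof -
    have "set (types k) = (\<Union>a\<in>set signs. \<Union>b\<in>set signs. \<Union>c\<in>set signs. \<Union>d\<in>set signs.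
        if 3 dvd (a + b) * (c + d) then {[a, c, b, d, a, c, b, d, a, c, b, d]} else {})"
    proof -
      have "types k = [[a, c, b, d, a, c, b, d, a, c, b, d].
          a \<leftarrow> signs, b \<leftarrow> signs, c \<leftarrow> signs, d \<leftarrow> signs, 3 dvd (a + b) * (c + d)]"
        using that unfolding types_def by (elim disjE) simp_all
      then show ?thesis
        by (simp only: set_concat set_map image_image if_distrib[of set] list.set)
    qed
    moreover have "map of_int ` (if P then {e} else {}) = (if P then {map of_int e :: 'a list} else {})"
      for P e by simp
    ultimately show ?thesis
      unfolding nz by (simp only: image_UN image_image zero list.map)
  qed
qed

section \<open>Bounds for the girth\<close>

lemma closed_walk_length:
  assumes "CARD('a::{field,finite}) = 3" "4 \<le> k" "2 \<le> n"
    and "closed_walk k n (l :: nat \<Rightarrow> 'a list) r" "0 \<notin> set (steps l n)" "0 \<notin> set (steps r n)"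
  shows "6 \<le> n" "9 \<le> k \<Longrightarrow> n \<noteq> 6"
proof -
  have k: "2 \<le> k" using assms(2) by simp
  \<comment> \<open>The given walk may start at any edge; after translation its unchanged increments
    decide closing.\<close>
  obtain l' r' where w: "closed_walk k n l' r'" "starts_at_zero k l' r'"
    "steps l' n = steps l n" "steps r' n = steps r n"
    using closed_walk_translate_to_zero[OF k assms(4)] by blast
  obtain us vs where uv: "steps l n = map of_int us" "set us \<subseteq> set signs"
      "steps r n = map of_int vs" "set vs \<subseteq> set signs"
    using ex_signs_if_nonzero[OF assms(1,5)] ex_signs_if_nonzero[OF assms(1,6)] by metis
  have len: "length us = n" "length vs = n"
    using uv by (metis length_map length_steps)+
  have c: "closes k us vs"
    using closed_walk_iff_closes[OF assms(1) k _ w(2), of n us vs] w(1,3,4) uv by (simp add: closed_walk_def)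
  note mem = zero_sum_signs_if_closes[OF c uv(2,4) len]
  show "6 \<le> n"
  proof (rule ccontr)
    assume "\<not> 6 \<le> n"
    then have "n \<in> set [2..<6]" using assms(3) unfolding set_upt by simp
    then show False using not_closes_if_less_6 mem closes_mono[OF c assms(2)] by blast
  qed
  show "n \<noteq> 6" if "9 \<le> k"
  proof
    assume "n = 6"
    then have "riffle us vs \<in> set (types 9)"
      using closes_iff_types[OF uv(2,4), of 9] closes_mono[OF c that] len by simp
    then show False by (simp add: types_def)
  qed
qed

text \<open>Cycles have even length \<open>2 * n\<close>, so excluding \<open>n = 6\<close> raises
  the bound from 12 to 14.\<close>

lemma girth_Lambda_ge:
  assumes "CARD('a::{field,finite}) = 3" "4 \<le> k"
  shows "12 \<le> girth (Lambda k :: ('a list + 'a list) pair_pre_digraph)"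
    and "9 \<le> k \<Longrightarrow> 14 \<le> girth (Lambda k :: ('a list + 'a list) pair_pre_digraph)"
proof -
  have *: "12 \<le> length p" "9 \<le> k \<Longrightarrow> 14 \<le> length p"
    if p: "pre_digraph.cycle (with_proj (Lambda k)) p" "3 \<le> length p"
    for p :: "(('a list + 'a list) \<times> ('a list + 'a list)) list"
  proof -
    obtain n and l r :: "nat \<Rightarrow> 'a list" where n: "length p = 2 * n" "2 \<le> n" "closed_walk k n l r"
      "0 \<notin> set (steps l n)" "0 \<notin> set (steps r n)"
      by (rule closed_walk_of_cycle[OF _ p]) (use assms(2) in auto)
    show "12 \<le> length p" "9 \<le> k \<Longrightarrow> 14 \<le> length p"
      using closed_walk_length[OF assms n(2-)] n(1) by auto
  qed
  show "12 \<le> girth (Lambda k :: ('a list + 'a list) pair_pre_digraph)"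
    unfolding girth_def by (rule INF_greatest) (use *(1) in \<open>auto simp: numeral_eq_enat\<close>)
  show "14 \<le> girth (Lambda k :: ('a list + 'a list) pair_pre_digraph)" if "9 \<le> k"
    unfolding girth_def by (rule INF_greatest) (use *(2) that in \<open>auto simp: numeral_eq_enat\<close>)
qed

lemma girth_Lambda_le_12:
  assumes "CARD('a::{field,finite}) = 3" "k \<in> {4..8}"
  shows "girth (Lambda k :: ('a list + 'a list) pair_pre_digraph) \<le> 12"
proof -
  \<comment> \<open>The word of the family for \<open>k = 8\<close> with both parameters 1; it
    belongs to the families for all smaller \<open>k\<close> as well.\<close>
  let ?e = "[1, 1, -1, -1, 1, 1, -1, -1, 1, 1, -1, -1] :: int list"
  have "k = 4 \<or> k = 5 \<or> k = 6 \<or> k = 7 \<or> k = 8" using assms(2) by auto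
  then have "?e \<in> set (types k)" by (auto simp: types_def signs_def)
  then have "(map of_int ?e :: 'a list) \<in> map of_int ` set (types k)" by (rule imageI)
  then have "has_cycle_of_type k (map of_int ?e :: 'a list)"
    using has_cycle_of_type_iff_types[OF assms(1) _ _ assms(2), of "map of_int ?e"] by simp
  then obtain n and l r :: "nat \<Rightarrow> 'a list" where n: "2 \<le> n" "closed_walk k n l r"
    "inj_on l {..<n}" "inj_on r {..<n}" and t: "riffle (steps l n) (steps r n) = map of_int ?e"
    unfolding has_cycle_of_type_iff by blast
  have "n = 6" using arg_cong[OF t, of length] by simp
  obtain p where p: "pre_digraph.cycle (with_proj (Lambda k :: ('a list + 'a list) pair_pre_digraph)) p"
    "length p = 2 * n"
    using cycle_of_closed_walk[OF n(2) _ n(3,4)] n(1) by auto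
  show ?thesis
    unfolding girth_def by (rule INF_lower2[of p]) (use p \<open>n = 6\<close> in \<open>auto simp: numeral_eq_enat\<close>)
qed

theorem theorem4:
  assumes "CARD('a::{field,finite}) = 3"
  shows
    "(\<forall>\<epsilon> :: 'a list. length \<epsilon> = 12 \<and> 0 \<notin> set \<epsilon> \<longrightarrow>
        (has_cycle_of_type 4 \<epsilon> \<longleftrightarrow>
          (\<exists>a\<in>-{0}. \<exists>b\<in>-{0}. \<exists>c\<in>-{0}. \<exists>r\<in>-{0}.
            \<epsilon> \<in> {[a, r, b, -r, a, r, b, -r, a, r, b, -r],
                 [a, r, b, -r, -a, -r, -a, -r, -b, r, a, r],
                 [a, r, a, r, c, -r, -a, -r, -a, -r, -c, r],
                 [a, r, b, r, b, r, -a, -r, -b, -r, -b, -r],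
                 [a, r, -a, r, a, r, -a, r, a, r, -a, r]})) \<and>
        (\<forall>k\<in>{5, 6}. has_cycle_of_type k \<epsilon> \<longleftrightarrow>
          (\<exists>a\<in>-{0}. \<exists>b\<in>-{0}. \<exists>c\<in>-{0}. \<exists>d\<in>-{0}.
            (a + b) * (c + d) = 0 \<and> \<epsilon> = [a, c, b, d, a, c, b, d, a, c, b, d])) \<and>
        (has_cycle_of_type 7 \<epsilon> \<longleftrightarrow>
          (\<exists>a\<in>-{0}. \<exists>b\<in>-{0}. \<exists>c\<in>-{0}.
            \<epsilon> = [a, c, b, -c, a, c, b, -c, a, c, b, -c])) \<and>
        (has_cycle_of_type 8 \<epsilon> \<longleftrightarrow>
          (\<exists>a\<in>-{0}. \<exists>c\<in>-{0}.
            \<epsilon> = [a, c, -a, -c, a, c, -a, -c, a, c, -a, -c]))) \<and>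
     (\<forall>k\<in>{4..8}. girth (Lambda k :: ('a list + 'a list) pair_pre_digraph) = 12) \<and>
     girth (Lambda 9 :: ('a list + 'a list) pair_pre_digraph) \<ge> 14"
proof (intro conjI allI impI ballI)
  note iff = has_cycle_of_type_iff_types[OF assms]
  fix \<epsilon> :: "'a list" assume \<epsilon>: "length \<epsilon> = 12 \<and> 0 \<notin> set \<epsilon>"
  show "has_cycle_of_type 4 \<epsilon> \<longleftrightarrow>
          (\<exists>a\<in>-{0}. \<exists>b\<in>-{0}. \<exists>c\<in>-{0}. \<exists>r\<in>-{0}.
            \<epsilon> \<in> {[a, r, b, -r, a, r, b, -r, a, r, b, -r],
                 [a, r, b, -r, -a, -r, -a, -r, -b, r, a, r],
                 [a, r, a, r, c, -r, -a, -r, -a, -r, -c, r],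
                 [a, r, b, r, b, r, -a, -r, -b, -r, -b, -r],
                 [a, r, -a, r, a, r, -a, r, a, r, -a, r]})"
    using iff[of \<epsilon> 4] \<epsilon> unfolding image_types[OF assms] UN_iff by simp
  show "has_cycle_of_type k \<epsilon> \<longleftrightarrow>
          (\<exists>a\<in>-{0}. \<exists>b\<in>-{0}. \<exists>c\<in>-{0}. \<exists>d\<in>-{0}.
            (a + b) * (c + d) = 0 \<and> \<epsilon> = [a, c, b, d, a, c, b, d, a, c, b, d])" if "k \<in> {5, 6}" for k
  proof -
    have "\<epsilon> \<in> (if P then {e} else {}) \<longleftrightarrow> P \<and> \<epsilon> = e" for P e by simp
    then show ?thesis
      using iff[of \<epsilon> k] \<epsilon> that image_types(2)[OF assms, of k] unfolding UN_iff by auto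
  qed
  show "has_cycle_of_type 7 \<epsilon> \<longleftrightarrow>
          (\<exists>a\<in>-{0}. \<exists>b\<in>-{0}. \<exists>c\<in>-{0}.
            \<epsilon> = [a, c, b, -c, a, c, b, -c, a, c, b, -c])"
    using iff[of \<epsilon> 7] \<epsilon> unfolding image_types[OF assms] UN_iff by simp
  show "has_cycle_of_type 8 \<epsilon> \<longleftrightarrow>
          (\<exists>a\<in>-{0}. \<exists>c\<in>-{0}.
            \<epsilon> = [a, c, -a, -c, a, c, -a, -c, a, c, -a, -c])"
    using iff[of \<epsilon> 8] \<epsilon> unfolding image_types[OF assms] UN_iff by simp
next
  show "girth (Lambda k :: ('a list + 'a list) pair_pre_digraph) = 12" if "k \<in> {4..8}" for k
    using girth_Lambda_le_12[OF assms that] girth_Lambda_ge(1)[OF assms, of k] that by auto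
  show "girth (Lambda 9 :: ('a list + 'a list) pair_pre_digraph) \<ge> 14"
    using girth_Lambda_ge(2)[OF assms, of 9] by simp
qed

end
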